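(* The Brouwer degree for weakly admissible triples in $\mathbb{R}^k$ satisfies the following three properties: (Normalization) $\deg(I,\mathbb{R}^k,0)=1$, where $I$ denotes the identity on $\mathbb{R}^k$. (Additivity) If $(f,U,y)$ is weakly admissible, and $U_1$ and $U_2$ are two disjoint open subsets of $U$ such that $f^{-1}(y)\cap U\subseteq U_1\cup U_2$, then $$\deg(f,U,y)=\deg(f,U_1,y)+\deg(f,U_2,y).$$ (Homotopy Invariance) If $(H,U,\alpha)$ is a weakly admissible homotopy of triples, then $$\deg(H(\cdot,0),U,\alpha(0))=\deg(H(\cdot,1),U,\alpha(1)).$$
   Context: Here $k$ is a positive integer, all maps are assumed continuous, and $\overline U$, $\partial U$ denote the closure and boundary of $U$ in $\mathbb{R}^k$. A map between metric spaces is proper if preimages of compact sets are compact. A function on a subset $X$ of $\mathbb{R}^k$ is $C^\infty$ if it admits a $C^\infty$ extension to an open neighborhood of $X$. Admissible triples and their degree: let $U\subseteq\mathbb{R}^k$ be open, $f$ an $\mathbb{R}^k$-valued map defined (at least) on $\overline U$, and $y\in\mathbb{R}^k$. The triple $(f,U,y)$ is admissible if $f$ is proper on $\overline U$ (i.e. $f|_{\overline U}$ is proper) and $f(x)\neq y$ for all $x\in\partial U$. It is regular if it is admissible, $f$ is $C^\infty$, and $\det f'(x)\ne0$ for all $x\in f^{-1}(y)\cap U$ (this set is then finite). For a regular triple, $\deg(f,U,y):=\sum_{x\in f^{-1}(y)\cap U}\mathrm{sign}(\det f'(x))$. For an admissible triple, $\deg(f,U,y):=\deg(g,U,z)$, where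 $(g,U,z)$ is any regular triple for which there are $\epsilon,\sigma>0$ with $|g(x)-f(x)|\le\epsilon$ for all $x\in\overline U$, $|z-y|\le\sigma$, and $\epsilon+\sigma<\mathrm{dist}(y,f(\partial U))$ (convention: $\mathrm{dist}(y,\emptyset)=+\infty$); this is well defined. Weakly admissible triples and their degree: a triple $(f,U,y)$ is weakly admissible if $U\subseteq\mathbb{R}^k$ is open, $f$ is an $\mathbb{R}^k$-valued map defined (at least) on $U$, and $y\in\mathbb{R}^k$ is such that $f^{-1}(y)\cap U$ is compact. Its degree is $\deg(f,U,y):=\deg(f,V,y)$ (degree of an admissible triple), where $V$ is any bounded open neighborhood of $f^{-1}(y)\cap U$ such that $\overline V\subseteq U$; this is well defined. Weakly admissible homotopies: $(H,U,\alpha)$, where $U\subseteq\mathbb{R}^k$ is open, $H$ is an $\mathbb{R}^k$-valued map defined (at least) on $U\times[0,1]$ and $\alpha:[0,1]\to\mathbb{R}^k$ is a path, is a weakly admissible homotopy of triples if the set $\{(x,\lambda)\in U\times[0,1]: H(x,\lambda)=\alpha(\lambda)\}$ is compact. *)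

theory Defs
  imports "HOL-Analysis.Analysis"
begin

text \<open>The dimension \<open>k \<ge> 1\<close> is \<open>CARD('n)\<close>. Maps defined on a subset of the space are represented by
  total functions, about which only the values on the relevant subset are constrained.\<close>

type_synonym 'n triple_map = "(real, 'n) vec \<Rightarrow> (real, 'n) vec"

text \<open>Maps of class \<open>C\<^sup>n\<close>, intended for open \<open>S\<close> only: the derivative is \<open>C\<^sup>n\<close> iff each of its evaluations
  at a fixed direction \<open>v\<close> is, which keeps the type of the function unchanged in the recursion.\<close>

primrec Ck_on_open ::
  "nat \<Rightarrow> ('a::euclidean_space) set \<Rightarrow> ('a \<Rightarrow> 'b::euclidean_space) \<Rightarrow> bool" where
  "Ck_on_open 0 S f \<longleftrightarrow> continuous_on S f"
| "Ck_on_open (Suc n) S f \<longleftrightarrow>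
     (\<forall>x\<in>S. f differentiable (at x)) \<and>
     (\<forall>v. Ck_on_open n S (\<lambda>x. frechet_derivative f (at x) v))"

definition smooth_on ::
  "('a::euclidean_space) set \<Rightarrow> ('a \<Rightarrow> 'b::euclidean_space) \<Rightarrow> bool" where
  "smooth_on X f \<longleftrightarrow>
     (\<exists>W g. open W \<and> X \<subseteq> W \<and> (\<forall>n. Ck_on_open n W g) \<and> (\<forall>x\<in>X. g x = f x))"

definition proper_on ::
  "('a::metric_space) set \<Rightarrow> ('a \<Rightarrow> 'b::metric_space) \<Rightarrow> bool" where
  "proper_on X f \<longleftrightarrow> (\<forall>K. compact K \<longrightarrow> compact {x \<in> X. f x \<in> K})"

definition jacobian_det :: "'n::finite triple_map \<Rightarrow> real^'n \<Rightarrow> real" where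
  "jacobian_det f x = det (matrix (frechet_derivative f (at x)))"

definition admissible :: "'n::finite triple_map \<Rightarrow> (real^'n) set \<Rightarrow> real^'n \<Rightarrow> bool" where
  "admissible f U y \<longleftrightarrow>
     open U \<and> continuous_on (closure U) f \<and> proper_on (closure U) f \<and>
     (\<forall>x\<in>frontier U. f x \<noteq> y)"

definition regular :: "'n::finite triple_map \<Rightarrow> (real^'n) set \<Rightarrow> real^'n \<Rightarrow> bool" where
  "regular f U y \<longleftrightarrow>
     admissible f U y \<and> smooth_on (closure U) f \<and>
     (\<forall>x\<in>U. f x = y \<longrightarrow> jacobian_det f x \<noteq> 0)"

text \<open>The floor only converts the real number \<open>sgn _ \<in> {-1, 0, 1}\<close> to an integer.\<close>

definition deg_regular :: "'n::finite triple_map \<Rightarrow> (real^'n) set \<Rightarrow> real^'n \<Rightarrow> int" where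
  "deg_regular f U y = (\<Sum>x | x \<in> U \<and> f x = y. \<lfloor>sgn (jacobian_det f x)\<rfloor>)"

text \<open>The distance bound is dropped for an empty boundary, where the distance is \<open>+\<infinity>\<close> by convention,
  whereas \<open>infdist y {} = 0\<close>.\<close>

definition regular_approx ::
  "'n::finite triple_map \<Rightarrow> (real^'n) set \<Rightarrow> real^'n \<Rightarrow> 'n triple_map \<Rightarrow> real^'n \<Rightarrow> bool" where
  "regular_approx f U y g z \<longleftrightarrow>
     regular g U z \<and>
     (\<exists>\<epsilon>>0. \<exists>\<sigma>>0. (\<forall>x\<in>closure U. norm (g x - f x) \<le> \<epsilon>) \<and> norm (z - y) \<le> \<sigma> \<and>
        (frontier U \<noteq> {} \<longrightarrow> \<epsilon> + \<sigma> < infdist y (f ` frontier U)))"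

text \<open>In the next two definitions, the definite description denotes the common value of the degree over
  all choices. It is meaningful for admissible and weakly admissible triples, respectively.\<close>

definition deg_admissible :: "'n::finite triple_map \<Rightarrow> (real^'n) set \<Rightarrow> real^'n \<Rightarrow> int" where
  "deg_admissible f U y =
     (THE d. \<exists>g z. regular_approx f U y g z \<and> d = deg_regular g U z)"

definition weakly_admissible :: "'n::finite triple_map \<Rightarrow> (real^'n) set \<Rightarrow> real^'n \<Rightarrow> bool" where
  "weakly_admissible f U y \<longleftrightarrow> open U \<and> continuous_on U f \<and> compact {x \<in> U. f x = y}"

definition deg :: "'n::finite triple_map \<Rightarrow> (real^'n) set \<Rightarrow> real^'n \<Rightarrow> int" where
  "deg f U y =
     (THE d. \<exists>V. open V \<and> bounded V \<and> {x \<in> U. f x = y} \<subseteq> V \<and> closure V \<subseteq> U \<and>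
        d = deg_admissible f V y)"

definition weakly_admissible_homotopy ::
  "((real^'n::finite) \<times> real \<Rightarrow> real^'n) \<Rightarrow> (real^'n) set \<Rightarrow> (real \<Rightarrow> real^'n) \<Rightarrow> bool" where
  "weakly_admissible_homotopy H U \<alpha> \<longleftrightarrow>
     open U \<and> continuous_on (U \<times> {0..1}) H \<and> path \<alpha> \<and>
     compact {(x, t) \<in> U \<times> {0..1}. H (x, t) = \<alpha> t}"

end

theory Submission
  imports Defs
begin

text \<open>The degree of a regular triple is recovered from an integral. Compose \<open>u\<close> with a map \<open>\<Psi>\<close> that acts
  coordinatewise by a nondecreasing function constant outside \<open>[-d, d]\<close>: the Jacobian of \<open>\<Psi> \<circ> u\<close> is
  supported near the zeros of \<open>u\<close>, and for small \<open>d\<close> its integral is the sum of the signs of \<open>det u'\<close>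
  at these zeros, times a positive constant. On the other hand, the integral of \<open>det w'\<close> vanishes for
  every compactly supported \<open>w\<close> of class \<open>C\<^sup>1\<close>, so that the integral of a Jacobian does not change under
  modifications on a compact set. If the segment from \<open>h\<^sub>0\<close> to \<open>h\<^sub>1\<close> avoids zero on the boundary, then
  \<open>h\<^sub>0 + c (h\<^sub>1 - h\<^sub>0)\<close> with a suitable cutoff \<open>c\<close> has the same zeros as \<open>h\<^sub>1\<close> and agrees with \<open>h\<^sub>0\<close> near the
  boundary, whence the sums of signs agree. This makes the degree well defined, since regular
  approximations exist by Stone--Weierstrass and Sard. The remaining properties follow by choosing one
  approximation that serves all the triples involved at once.\<close>

section \<open>Calculus of class \<open>C\<^sup>1\<close> maps\<close>

text \<open>The derivative is an explicit argument, so that formulas for it can be carried along and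
  fed into \<open>det (matrix _)\<close>. Continuity is asked for one direction \<open>v\<close> at
  a time, which in finite dimension amounts to continuity in the operator norm. Derivatives are
  taken at \<open>x\<close> in the whole space, so \<open>S\<close> is meant to be open.\<close>

definition C1_on ::
  "('a::euclidean_space) set \<Rightarrow> ('a \<Rightarrow> 'b::real_normed_vector) \<Rightarrow> ('a \<Rightarrow> 'a \<Rightarrow> 'b) \<Rightarrow> bool" where
  "C1_on S f f' \<longleftrightarrow>
     (\<forall>x\<in>S. (f has_derivative f' x) (at x)) \<and> (\<forall>v. continuous_on S (\<lambda>x. f' x v))"

lemma C1_on_D:
  assumes "C1_on S f f'"
  shows "x \<in> S \<Longrightarrow> (f has_derivative f' x) (at x)" "continuous_on S (\<lambda>x. f' x v)"
  using assms by (auto simp: C1_on_def)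

lemma C1_on_linear: "C1_on S f f' \<Longrightarrow> x \<in> S \<Longrightarrow> linear (f' x)"
  using C1_on_D(1) has_derivative_linear by blast

lemma C1_on_continuous_on: "C1_on S f f' \<Longrightarrow> continuous_on S f"
  by (meson C1_on_D(1) continuous_at_imp_continuous_on has_derivative_continuous)

lemma C1_on_subset: "C1_on T f f' \<Longrightarrow> S \<subseteq> T \<Longrightarrow> C1_on S f f'"
  unfolding C1_on_def by (meson continuous_on_subset subset_eq)

lemma C1_on_Un:
  assumes "C1_on S f f'" "C1_on T f f'" "open S" "open T"
  shows "C1_on (S \<union> T) f f'"
  using assms unfolding C1_on_def by (auto intro!: continuous_on_open_Un)

lemma C1_on_const: "C1_on S (\<lambda>x. c) (\<lambda>x v. 0)"
  unfolding C1_on_def by auto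

lemma C1_on_transform:
  assumes "C1_on S f f'" "open S" "\<And>x. x \<in> S \<Longrightarrow> f x = g x" "\<And>x. x \<in> S \<Longrightarrow> f' x = g' x"
  shows "C1_on S g g'"
  unfolding C1_on_def
proof (intro conjI ballI allI)
  fix x assume x: "x \<in> S"
  show "(g has_derivative g' x) (at x)"
    using has_derivative_transform_within_open[OF C1_on_D(1)[OF assms(1) x] assms(2) x] assms(3,4) x
    by auto
next
  fix v show "continuous_on S (\<lambda>x. g' x v)"
    using C1_on_D(2)[OF assms(1), of v] assms(4) by (simp cong: continuous_on_cong)
qed

text \<open>A derivative depends only on the function near the point. This identifies two explicit
  derivative formulas wherever the functions agree on an open set.\<close>

lemma C1_on_unique:
  assumes "C1_on S f f'" "C1_on T g g'" "open W" "x \<in> W" "W \<subseteq> S" "W \<subseteq> T"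
    "\<And>x. x \<in> W \<Longrightarrow> f x = g x"
  shows "f' x = g' x"
proof -
  have "(g has_derivative f' x) (at x)"
    using has_derivative_transform_within_open[OF C1_on_D(1)[OF assms(1)] assms(3,4)] assms by blast
  moreover have "(g has_derivative g' x) (at x)" using C1_on_D(1) assms by blast
  ultimately show ?thesis by (rule has_derivative_unique)
qed

lemma C1_on_add:
  "C1_on S f f' \<Longrightarrow> C1_on S g g' \<Longrightarrow> C1_on S (\<lambda>x. f x + g x) (\<lambda>x v. f' x v + g' x v)"
  unfolding C1_on_def by (auto intro!: derivative_eq_intros continuous_intros)

lemma C1_on_diff:
  "C1_on S f f' \<Longrightarrow> C1_on S g g' \<Longrightarrow> C1_on S (\<lambda>x. f x - g x) (\<lambda>x v. f' x v - g' x v)"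
  unfolding C1_on_def by (auto intro!: derivative_eq_intros continuous_intros)

lemma C1_on_sum:
  assumes "finite I" "\<And>i. i \<in> I \<Longrightarrow> C1_on S (f i) (f' i)"
  shows "C1_on S (\<lambda>x. \<Sum>i\<in>I. f i x) (\<lambda>x v. \<Sum>i\<in>I. f' i x v)"
  using assms by (induction I) (auto intro: C1_on_const C1_on_add)

lemma C1_on_scaleR:
  fixes c :: "'a::euclidean_space \<Rightarrow> real"
  assumes c: "C1_on S c c'" and f: "C1_on S f f'"
  shows "C1_on S (\<lambda>x. c x *\<^sub>R f x) (\<lambda>x v. c x *\<^sub>R f' x v + c' x v *\<^sub>R f x)"
  using c f C1_on_continuous_on[OF c] C1_on_continuous_on[OF f]
  unfolding C1_on_def by (auto intro!: derivative_eq_intros continuous_intros)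

lemma C1_on_compose_real:
  fixes f :: "'a::euclidean_space \<Rightarrow> real" and h :: "real \<Rightarrow> real"
  assumes f: "C1_on S f f'" and h: "\<And>s. (h has_real_derivative h' s) (at s)"
    and h': "continuous_on UNIV h'"
  shows "C1_on S (\<lambda>x. h (f x)) (\<lambda>x v. h' (f x) * f' x v)"
  unfolding C1_on_def
proof (intro conjI ballI allI)
  fix x assume x: "x \<in> S"
  have "(h has_derivative (\<lambda>v. h' (f x) * v)) (at (f x))"
    using h[of "f x"] by (simp add: has_field_derivative_def)
  from has_derivative_compose[OF C1_on_D(1)[OF f x] this]
  show "((\<lambda>x. h (f x)) has_derivative (\<lambda>v. h' (f x) * f' x v)) (at x)" .
next
  fix v
  have "continuous_on S (\<lambda>x. h' (f x))"
    by (rule continuous_on_compose2[OF h' C1_on_continuous_on[OF f]]) auto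
  then show "continuous_on S (\<lambda>x. h' (f x) * f' x v)"
    using C1_on_D(2)[OF f] by (intro continuous_intros)
qed

lemma C1_on_vec_lambda:
  fixes f :: "'n::finite \<Rightarrow> 'a::euclidean_space \<Rightarrow> real"
  assumes "\<And>i. C1_on S (f i) (f' i)"
  shows "C1_on S (\<lambda>x. \<chi> i. f i x) (\<lambda>x v. \<chi> i. f' i x v)"
  unfolding C1_on_def
proof (intro conjI ballI allI)
  fix x assume x: "x \<in> S"
  show "((\<lambda>x. \<chi> i. f i x) has_derivative (\<lambda>v. \<chi> i. f' i x v)) (at x)"
  proof (subst has_derivative_componentwise_within, intro ballI)
    fix b :: "real^'n" assume "b \<in> Basis"
    then obtain i where b: "b = axis i 1" by (auto simp: Basis_vec_def)
    show "((\<lambda>x. (\<chi> i. f i x) \<bullet> b) has_derivative (\<lambda>v. (\<chi> i. f' i x v) \<bullet> b)) (at x)"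
      using C1_on_D(1)[OF assms x, of i] by (simp add: b inner_axis)
  qed
next
  fix v show "continuous_on S (\<lambda>x. \<chi> i. f' i x v)"
    using C1_on_D(2)[OF assms] by (intro continuous_intros)
qed

lemma C1_on_vec_nth:
  fixes f :: "'a::euclidean_space \<Rightarrow> real^'n"
  assumes "C1_on S f f'"
  shows "C1_on S (\<lambda>x. f x $ i) (\<lambda>x v. f' x v $ i)"
  using assms unfolding C1_on_def
  by (auto intro!: continuous_intros bounded_linear.has_derivative[OF bounded_linear_vec_nth])

lemma C1_on_norm_sq:
  fixes a :: "'a::euclidean_space"
  shows "C1_on S (\<lambda>x. (norm (x - a))\<^sup>2) (\<lambda>x v. 2 * ((x - a) \<bullet> v))"
  unfolding C1_on_def power2_norm_eq_inner
  by (auto intro!: derivative_eq_intros continuous_intros simp: inner_commute)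

lemma continuous_on_det_matrix:
  fixes A :: "'a::topological_space \<Rightarrow> real^'n \<Rightarrow> real^'n"
  assumes "\<And>v. continuous_on S (\<lambda>x. A x v)"
  shows "continuous_on S (\<lambda>x. det (matrix (A x)))"
  unfolding det_def matrix_def
  by (auto intro!: continuous_intros continuous_on_sum continuous_on_prod assms)

section \<open>Piecewise quadratic steps and cutoff functions\<close>

text \<open>A second difference of \<open>(max 0 s)^2\<close>: for \<open>d >= 0\<close> it is 0 up
  to \<open>-d\<close> and \<open>2 * d^2\<close> from \<open>d\<close> on, and it is of class
  C1.\<close>

definition ramp :: "real \<Rightarrow> real \<Rightarrow> real" where
  "ramp d s = (max 0 (s + d))\<^sup>2 - 2 * (max 0 s)\<^sup>2 + (max 0 (s - d))\<^sup>2"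

text \<open>The derivative of \<open>ramp d\<close>: for \<open>d >= 0\<close> a hat of height
  \<open>2 * d\<close> over \<open>[-d, d]\<close>.\<close>

definition tent :: "real \<Rightarrow> real \<Rightarrow> real" where
  "tent d s = 2 * max 0 (s + d) - 4 * max 0 s + 2 * max 0 (s - d)"

lemma max_0_sq_derivative: "((\<lambda>s::real. (max 0 s)\<^sup>2) has_real_derivative 2 * max 0 s) (at s)"
proof -
  consider "s < 0" | "s = 0" | "s > 0" by linarith
  then show ?thesis
  proof cases
    case 1
    have "((\<lambda>s::real. 0) has_real_derivative 2 * max 0 s) (at s)" using 1 by auto
    then show ?thesis
      by (rule has_field_derivative_transform_within_open[of _ _ _ "{..<0}"]) (use 1 in auto)
  next
    case 2
    have "((\<lambda>h::real. (max 0 h)\<^sup>2 / h) \<longlongrightarrow> 0) (at 0)"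
    proof (rule Lim_null_comparison)
      show "\<forall>\<^sub>F h::real in at 0. norm ((max 0 h)\<^sup>2 / h) \<le> \<bar>h\<bar>"
        by (auto simp: max_def power2_eq_square intro!: always_eventually)
      show "((\<lambda>h::real. \<bar>h\<bar>) \<longlongrightarrow> 0) (at 0)"
        by (rule tendsto_rabs_zero) (rule tendsto_ident_at)
    qed
    then show ?thesis using 2 by (simp add: has_field_derivative_iff)
  next
    case 3
    have "((\<lambda>s::real. s\<^sup>2) has_real_derivative 2 * max 0 s) (at s)"
      using 3 by (auto intro!: derivative_eq_intros)
    then show ?thesis
      by (rule has_field_derivative_transform_within_open[of _ _ _ "{0<..}"]) (use 3 in auto)
  qed
qed

lemma ramp_derivative: "(ramp d has_real_derivative tent d s) (at s)"
proof -
  have "((\<lambda>s. (max 0 (s + e))\<^sup>2) has_real_derivative 2 * max 0 (s + e)) (at s)" for e s :: real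
    using DERIV_shift[of "\<lambda>s. (max 0 s)\<^sup>2" "2 * max 0 (s + e)" s e] max_0_sq_derivative[of "s + e"]
    by simp
  from DERIV_add[OF DERIV_diff[OF this[of d] DERIV_cmult[OF max_0_sq_derivative, of 2]] this[of "-d"]]
  show ?thesis unfolding ramp_def[abs_def] tent_def by simp
qed

lemma continuous_on_tent [continuous_intros]:
  "continuous_on S f \<Longrightarrow> continuous_on S (\<lambda>x. tent d (f x))"
  unfolding tent_def by (intro continuous_intros)

lemma tent_nonneg: "0 \<le> d \<Longrightarrow> 0 \<le> tent d s"
  by (auto simp: tent_def max_def)

lemma tent_pos: "\<bar>s\<bar> < d \<Longrightarrow> 0 < tent d s"
  by (auto simp: tent_def max_def)

lemma tent_eq_0: "0 \<le> d \<Longrightarrow> d \<le> \<bar>s\<bar> \<Longrightarrow> tent d s = 0"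
  by (auto simp: tent_def max_def)

text \<open>\<open>ramp (1/2)\<close> rises from 0 to 1/2 over \<open>[-1/2, 1/2]\<close>; the shift
  and the factor 2 make it rise from 0 to 1 over \<open>[0, 1]\<close>.\<close>

definition C1_step :: "real \<Rightarrow> real" where
  "C1_step s = 2 * ramp (1/2) (s - 1/2)"

lemma C1_step_derivative:
  "(C1_step has_real_derivative 2 * tent (1/2) (s - 1/2)) (at s)"
  using DERIV_shift[of "ramp (1/2)" "tent (1/2) (s - 1/2)" s "-1/2"] ramp_derivative
  unfolding C1_step_def[abs_def] by (auto intro!: derivative_eq_intros)

lemma C1_step_eq_0: "s \<le> 0 \<Longrightarrow> C1_step s = 0"
  by (auto simp: C1_step_def ramp_def max_def)

lemma C1_step_eq_1: "1 \<le> s \<Longrightarrow> C1_step s = 1"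
  by (auto simp: C1_step_def ramp_def max_def power2_eq_square algebra_simps)

lemma C1_step_range: "0 \<le> C1_step s" "C1_step s \<le> 1"
proof -
  have mono: "C1_step s \<le> C1_step t" if "s \<le> t" for s t
    by (rule DERIV_nonneg_imp_nondecreasing[OF that])
      (use C1_step_derivative tent_nonneg in fastforce)
  show "0 \<le> C1_step s" using mono[of "min s 0" s] C1_step_eq_0 by simp
  show "C1_step s \<le> 1" using mono[of s "max s 1"] C1_step_eq_1 by simp
qed

text \<open>Finitely many balls of half size cover \<open>K\<close>. The sum of their bumps is at
  least 1 there, and a further \<open>C1_step\<close> caps it at 1. So \<open>c\<close> is 1 on an
  open set \<open>N\<close> around \<open>K\<close>, which is what allows derivatives to be compared
  at points of \<open>K\<close>.\<close>

lemma C1_cutoff: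
  fixes K V :: "'a::euclidean_space set"
  assumes K: "compact K" and V: "open V" and KV: "K \<subseteq> V"
  obtains c c' N L where "C1_on UNIV c c'" "\<And>x. 0 \<le> c x" "\<And>x. c x \<le> (1::real)"
    "open N" "K \<subseteq> N" "\<And>x. x \<in> N \<Longrightarrow> c x = 1"
    "compact L" "L \<subseteq> V" "\<And>x. x \<notin> L \<Longrightarrow> c x = 0"
proof -
  have "\<exists>r>0. cball a r \<subseteq> V" if "a \<in> K" for a
    using V KV that open_contains_cball by blast
  then obtain r where r: "\<And>a. a \<in> K \<Longrightarrow> 0 < r a \<and> cball a (r a) \<subseteq> V" by metis
  have "K \<subseteq> (\<Union>a\<in>K. ball a (r a / 2))" using r by force
  then obtain I where I: "I \<subseteq> K" "finite I" and cov: "K \<subseteq> (\<Union>a\<in>I. ball a (r a / 2))"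
    using compactE_image[OF K, of K "\<lambda>a. ball a (r a / 2)"] by auto
  \<comment> \<open>The argument of \<open>C1_step\<close> is at least 1 on the ball of radius
    \<open>r a / 2\<close> and at most -2 outside the ball of radius \<open>r a\<close>.\<close>
  define b where "b a x = C1_step (2 - (norm (x - a))\<^sup>2 / (r a / 2)\<^sup>2)" for a x
  define c where "c x = C1_step (\<Sum>a\<in>I. b a x)" for x
  have b1: "b a x = 1" if "a \<in> I" "x \<in> ball a (r a / 2)" for a x
  proof -
    have "(norm (x - a))\<^sup>2 \<le> (r a / 2)\<^sup>2"
      using that by (intro power_mono) (auto simp: dist_norm norm_minus_commute)
    moreover have "0 < (r a / 2)\<^sup>2" using r that I by (intro zero_less_power) auto
    ultimately have "(norm (x - a))\<^sup>2 / (r a / 2)\<^sup>2 \<le> 1" by (simp add: divide_le_eq_1)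
    then show ?thesis unfolding b_def by (intro C1_step_eq_1) simp
  qed
  have b0: "b a x = 0" if "a \<in> I" "x \<notin> cball a (r a)" for a x
  proof -
    have "(r a)\<^sup>2 \<le> (norm (x - a))\<^sup>2"
      using that r[of a] I by (intro power_mono) (auto simp: dist_norm norm_minus_commute)
    moreover have "2 * (r a / 2)\<^sup>2 = (r a)\<^sup>2 / 2" by (simp add: power_divide)
    ultimately have "2 * (r a / 2)\<^sup>2 \<le> (norm (x - a))\<^sup>2"
      using zero_le_power2[of "norm (x - a)"] by linarith
    moreover have "0 < (r a / 2)\<^sup>2" using r that I by (intro zero_less_power) auto
    ultimately have "2 \<le> (norm (x - a))\<^sup>2 / (r a / 2)\<^sup>2" by (simp add: pos_le_divide_eq)
    then show ?thesis unfolding b_def by (intro C1_step_eq_0) simp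
  qed
  have "C1_on UNIV (\<lambda>x. 2 + (-1 / (r a / 2)\<^sup>2) *\<^sub>R (norm (x - a))\<^sup>2)
      (\<lambda>x v. 0 + ((-1 / (r a / 2)\<^sup>2) *\<^sub>R (2 * ((x - a) \<bullet> v)) + 0 *\<^sub>R (norm (x - a))\<^sup>2))" for a :: 'a
    by (intro C1_on_add C1_on_const C1_on_scaleR C1_on_norm_sq)
  then have "\<exists>f'. C1_on UNIV (\<lambda>x. 2 - (norm (x - a))\<^sup>2 / (r a / 2)\<^sup>2) f'" for a :: 'a by auto
  moreover have sc: "continuous_on UNIV (\<lambda>s::real. 2 * tent (1/2) (s - 1/2))"
    by (intro continuous_intros)
  ultimately have "\<exists>b'. C1_on UNIV (b a) b'" for a
    unfolding b_def using C1_on_compose_real[OF _ C1_step_derivative sc] by blast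
  then obtain b' where "\<And>a. C1_on UNIV (b a) (b' a)" by metis
  from C1_on_sum[OF I(2) this, of "\<lambda>a. a"]
  have "C1_on UNIV (\<lambda>x. \<Sum>a\<in>I. b a x) (\<lambda>x v. \<Sum>a\<in>I. b' a x v)" .
  from C1_on_compose_real[OF this C1_step_derivative sc]
  obtain c' where c': "C1_on UNIV c c'" unfolding c_def by blast
  show thesis
  proof
    show "C1_on UNIV c c'" by fact
    show "0 \<le> c x" "c x \<le> 1" for x unfolding c_def by (rule C1_step_range)+
    show "open (\<Union>a\<in>I. ball a (r a / 2))" by auto
    show "K \<subseteq> (\<Union>a\<in>I. ball a (r a / 2))" by fact
    show "compact (\<Union>a\<in>I. cball a (r a))" using I by (intro compact_UN) auto
    show "(\<Union>a\<in>I. cball a (r a)) \<subseteq> V" using r I by blast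
    show "c x = 0" if "x \<notin> (\<Union>a\<in>I. cball a (r a))" for x
      using that b0 by (auto simp: c_def C1_step_eq_0)
    show "c x = 1" if x: "x \<in> (\<Union>a\<in>I. ball a (r a / 2))" for x
    proof -
      from x obtain a where a: "a \<in> I" "x \<in> ball a (r a / 2)" by blast
      have "1 = b a x" using b1 a by simp
      also have "\<dots> \<le> (\<Sum>a\<in>I. b a x)"
        using a I by (intro member_le_sum) (auto simp: b_def C1_step_range)
      finally show ?thesis unfolding c_def by (rule C1_step_eq_1)
    qed
  qed
qed

section \<open>Integrals of Jacobians\<close>

text \<open>In each Leibniz term, expand the product over the set \<open>X\<close> of rows that
  contribute the factor \<open>t * W\<close>; the remaining rows contribute entries of the identity.
  Grouping by \<open>card X\<close> gives the powers of \<open>t\<close>, and for the top power only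
  \<open>X = UNIV\<close> is left.\<close>

lemma det_add_scaleR_expansion:
  fixes w' :: "'a::topological_space \<Rightarrow> real^'n \<Rightarrow> real^'n"
  obtains c :: "nat \<Rightarrow> 'a \<Rightarrow> real"
  where "\<And>x t. det (matrix (\<lambda>v. v + t *\<^sub>R w' x v)) = (\<Sum>k\<le>CARD('n). c k x * t ^ k)"
    "\<And>x. c CARD('n) x = det (matrix (w' x))"
    "\<And>k S. (\<And>v. continuous_on S (\<lambda>x. w' x v)) \<Longrightarrow> continuous_on S (c k)"
proof -
  let ?P = "{p. p permutes (UNIV :: 'n set)}"
  define W where "W x i j = w' x (axis j 1) $ i" for x and i j :: 'n
  define I where "I i j = (if i = j then 1 else 0 :: real)" for i j :: 'n
  define c where "c k x = (\<Sum>p\<in>?P. of_int (sign p) *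
      (\<Sum>X\<in>{X. X \<subseteq> UNIV \<and> card X = k}. (\<Prod>i\<in>X. W x i (p i)) * (\<Prod>i\<in>UNIV - X. I i (p i))))" for k x
  have fin: "finite ?P" by (simp add: finite_permutations)
  show thesis
  proof
    fix x t
    have "det (matrix (\<lambda>v. v + t *\<^sub>R w' x v)) =
        (\<Sum>p\<in>?P. of_int (sign p) * (\<Prod>i\<in>UNIV. t * W x i (p i) + I i (p i)))"
      unfolding det_def matrix_def W_def I_def by (simp add: axis_def add.commute)
    also have "\<dots> = (\<Sum>p\<in>?P. of_int (sign p) *
        (\<Sum>X\<in>Pow UNIV. t ^ card X * ((\<Prod>i\<in>X. W x i (p i)) * (\<Prod>i\<in>UNIV - X. I i (p i)))))"
      by (subst prod_add) (auto simp: prod.distrib mult.assoc)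
    also have "\<dots> = (\<Sum>p\<in>?P. of_int (sign p) *
        (\<Sum>k\<le>CARD('n). \<Sum>X\<in>{X. X \<in> Pow UNIV \<and> card X = k}.
          t ^ card X * ((\<Prod>i\<in>X. W x i (p i)) * (\<Prod>i\<in>UNIV - X. I i (p i)))))"
      by (subst sum.group) (auto intro: card_mono)
    also have "\<dots> = (\<Sum>p\<in>?P. \<Sum>k\<le>CARD('n). of_int (sign p) *
        (\<Sum>X\<in>{X. X \<subseteq> UNIV \<and> card X = k}.
          ((\<Prod>i\<in>X. W x i (p i)) * (\<Prod>i\<in>UNIV - X. I i (p i)))) * t ^ k)"
      by (auto simp: sum_distrib_left sum_distrib_right mult_ac intro!: sum.cong)
    also have "\<dots> = (\<Sum>k\<le>CARD('n). c k x * t ^ k)"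
      unfolding c_def sum_distrib_right by (rule sum.swap)
    finally show "det (matrix (\<lambda>v. v + t *\<^sub>R w' x v)) = (\<Sum>k\<le>CARD('n). c k x * t ^ k)" .
  next
    fix x
    have "{X. X \<subseteq> UNIV \<and> card X = CARD('n)} = {UNIV :: 'n set}"
      by (auto dest: card_subset_eq[rotated -1])
    then show "c CARD('n) x = det (matrix (w' x))"
      unfolding c_def det_def matrix_def W_def by simp
  next
    fix k S assume "\<And>v. continuous_on S (\<lambda>x. w' x v)"
    then show "continuous_on S (c k)"
      unfolding c_def[abs_def] W_def
      by (intro continuous_intros continuous_on_sum continuous_on_prod)
  qed
qed

text \<open>The derivative is bounded on \<open>K\<close> by continuity and vanishes on the open
  complement of \<open>K\<close>. The mean value inequality turns this bound into a Lipschitz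
  constant.\<close>

lemma C1_compact_support_derivative_bound:
  fixes w :: "'a::euclidean_space \<Rightarrow> 'b::euclidean_space"
  assumes w: "C1_on UNIV w w'" and K: "compact K" and supp: "\<And>x. x \<notin> K \<Longrightarrow> w x = 0"
  obtains M where "0 < M" "\<And>x v. norm (w' x v) \<le> M * norm v"
    "\<And>x y. norm (w x - w y) \<le> M * norm (x - y)"
proof -
  have bl: "bounded_linear (w' x)" for x
    using C1_on_D(1)[OF w] has_derivative_bounded_linear by blast
  define W where "W x = Blinfun (w' x)" for x
  have W: "blinfun_apply (W x) = w' x" for x
    unfolding W_def using bl by (rule bounded_linear_Blinfun_apply)
  have "continuous_on K W"
    by (rule continuous_on_blinfun_componentwise)
      (simp add: W continuous_on_subset[OF C1_on_D(2)[OF w]])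
  then have "bounded (W ` K)" using K compact_continuous_image compact_imp_bounded by blast
  then obtain M where M: "0 < M" "\<And>x. x \<in> K \<Longrightarrow> norm (W x) \<le> M"
    unfolding bounded_pos by auto
  have bd: "norm (w' x v) \<le> M * norm v" for x v
  proof (cases "x \<in> K")
    case True
    have "norm (w' x v) \<le> norm (W x) * norm v" using norm_blinfun[of "W x" v] W by simp
    also have "\<dots> \<le> M * norm v" using M(2)[OF True] by (simp add: mult_right_mono)
    finally show ?thesis .
  next
    case False
    have "w' x = (\<lambda>v. 0)"
      by (rule C1_on_unique[OF w C1_on_const[of UNIV 0], of "- K"])
        (use False K supp compact_imp_closed in auto)
    then show ?thesis using M by simp
  qed
  have "norm (w x - w y) \<le> M * norm (x - y)" for x y
    by (rule differentiable_bound[of UNIV w w'])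
      (use C1_on_D(1)[OF w] bd in \<open>auto intro: onorm_bound has_derivative_at_withinI M(1)[THEN less_imp_le]\<close>)
  with M(1) bd show thesis using that by blast
qed

text \<open>For small \<open>t\<close> the map \<open>id + t w\<close> permutes a box containing the support of \<open>w\<close>, so the integral of
  its Jacobian over the box is the volume of the box. This integral is a polynomial in \<open>t\<close>, and the
  integral of \<open>det w'\<close> is its leading coefficient.\<close>

lemma integral_det_compact_support:
  fixes w :: "real^'n::{finite,wellorder} \<Rightarrow> real^'n::_"
  assumes w: "C1_on UNIV w w'" and K: "compact K" and supp: "\<And>x. x \<notin> K \<Longrightarrow> w x = 0"
  shows "((\<lambda>x. det (matrix (w' x))) has_integral 0) UNIV"
proof -
  obtain M where M: "0 < M" "\<And>x v. norm (w' x v) \<le> M * norm v"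
    "\<And>x y. norm (w x - w y) \<le> M * norm (x - y)"
    using C1_compact_support_derivative_bound[OF w K supp] by blast
  obtain a where a: "K \<subseteq> cbox (-a) a"
    using bounded_subset_cbox_symmetric[OF compact_imp_bounded[OF K]] by blast
  define B where "B = cbox (-a) a"
  obtain c :: "nat \<Rightarrow> real^'n::_ \<Rightarrow> real" where
    c: "\<And>x t. det (matrix (\<lambda>v. v + t *\<^sub>R w' x v)) = (\<Sum>k\<le>CARD('n). c k x * t ^ k)"
      "\<And>x. c CARD('n) x = det (matrix (w' x))"
      "\<And>k S. (\<And>v. continuous_on S (\<lambda>x. w' x v)) \<Longrightarrow> continuous_on S (c k)"
    by (rule det_add_scaleR_expansion[of w']) blast
  have cint: "c k integrable_on B" for k
    unfolding B_def
    by (intro integrable_continuous c(3) continuous_on_subset[OF C1_on_D(2)[OF w]]) auto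
  define b where "b k = integral B (c k)" for k
  \<comment> \<open>The condition \<open>t * M < 1\<close> makes \<open>t w\<close> a contraction,
    so that \<open>F\<close> is a bijection with invertible derivative.\<close>
  have poly: "(\<Sum>k\<le>CARD('n). b k * t ^ k) = measure lebesgue B" if t: "0 \<le> t" "t * M < 1" for t
  proof -
    define F where "F x = x + t *\<^sub>R w x" for x
    have inj: "inj F"
    proof (rule injI)
      fix x y assume "F x = F y"
      then have "x - y = - (t *\<^sub>R (w x - w y))" unfolding F_def by (simp add: algebra_simps)
      then have "norm (x - y) = t * norm (w x - w y)" using t(1) by simp
      also have "\<dots> \<le> t * (M * norm (x - y))" using M(3) t(1) by (intro mult_left_mono)
      finally have "norm (x - y) * (1 - t * M) \<le> 0" by (simp add: algebra_simps)
      then have "norm (x - y) \<le> 0" using t(2) by (simp add: mult_le_0_iff)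
      then show "x = y" by simp
    qed
    have surj: "\<exists>x. F x = y" for y
    proof -
      \<comment> \<open>A preimage of \<open>y\<close> under \<open>F\<close> is a fixed point of
        the contraction \<open>x \<mapsto> y - t w x\<close>.\<close>
      have "\<exists>!x. y - t *\<^sub>R w x = x"
      proof (rule banach_fix_type)
        show "0 \<le> t * M" "t * M < 1" using t M(1) by auto
        have "norm (t *\<^sub>R (w z - w x)) \<le> t * (M * norm (x - z))" for x z
          using M(3)[of z x] t(1) by (simp add: mult_left_mono norm_minus_commute)
        then show "\<forall>x z. dist (y - t *\<^sub>R w x) (y - t *\<^sub>R w z) \<le> t * M * dist x z"
          by (simp add: dist_norm algebra_simps)
      qed
      then show ?thesis unfolding F_def by (metis add_diff_cancel_right' diff_add_cancel)
    qed
    have out: "F x = x" if "x \<notin> B" for x using that supp a unfolding F_def B_def by auto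
    \<comment> \<open>\<open>F\<close> is the identity off \<open>B\<close>: a point of
      \<open>B\<close> mapped to a point outside \<open>B\<close> would share its image with that
      point, against injectivity.\<close>
    have FB: "F ` B = B"
    proof
      show "F ` B \<subseteq> B"
      proof clarify
        fix x assume x: "x \<in> B"
        show "F x \<in> B"
        proof (rule ccontr)
          assume "F x \<notin> B"
          then have "F (F x) = F x" by (rule out)
          then show False using inj x \<open>F x \<notin> B\<close> by (metis injD)
        qed
      qed
      show "B \<subseteq> F ` B" using surj out by (metis image_iff subsetI)
    qed
    have dF: "(F has_derivative (\<lambda>v. v + t *\<^sub>R w' x v)) (at x)" for x
      unfolding F_def using C1_on_D(1)[OF w] by (auto intro!: derivative_eq_intros)
    have nz: "det (matrix (\<lambda>v. v + s *\<^sub>R w' x v)) \<noteq> 0" if s: "0 \<le> s" "s \<le> t" for s x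
    proof -
      have lin: "linear (\<lambda>v. v + s *\<^sub>R w' x v)"
        using C1_on_linear[OF w, of x]
        by (intro linear_compose_add linear_compose_scale_right) (auto simp: linear_iff)
      have "v = 0" if "v + s *\<^sub>R w' x v = 0" for v
      proof -
        have "v = - (s *\<^sub>R w' x v)" using that by (simp add: eq_neg_iff_add_eq_0)
        then have "norm v = s * norm (w' x v)" using s by (metis abs_of_nonneg norm_minus_cancel norm_scaleR)
        also have "\<dots> \<le> t * (M * norm v)" using M(1) s M(2) by (intro mult_mono) auto
        finally have "norm v * (1 - t * M) \<le> 0" by (simp add: algebra_simps)
        then have "norm v \<le> 0" using t(2) by (simp add: mult_le_0_iff)
        then show ?thesis by simp
      qed
      then have "inj (\<lambda>v. v + s *\<^sub>R w' x v)" using linear_injective_0[OF lin] by blast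
      then show ?thesis using lin det_nz_iff_inj by blast
    qed
    \<comment> \<open>The determinant is 1 for \<open>s = 0\<close> and has no zero for
      \<open>s\<close> in \<open>[0, t]\<close>, hence stays positive. This removes the absolute
      value from the change of variables formula.\<close>
    have pos: "0 < det (matrix (\<lambda>v. v + t *\<^sub>R w' x v))" for x
    proof (rule ccontr)
      assume "\<not> 0 < det (matrix (\<lambda>v. v + t *\<^sub>R w' x v))"
      then have "det (matrix (\<lambda>v. v + t *\<^sub>R w' x v)) \<le> 0" by simp
      moreover have "det (matrix (\<lambda>v. v + 0 *\<^sub>R w' x v)) = 1"
        by (simp add: matrix_id_mat_1[unfolded id_def])
      moreover have "continuous_on {0..t} (\<lambda>s. det (matrix (\<lambda>v. v + s *\<^sub>R w' x v)))"
        unfolding c(1) by (intro continuous_intros)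
      ultimately obtain s where "0 \<le> s" "s \<le> t" "det (matrix (\<lambda>v. v + s *\<^sub>R w' x v)) = 0"
        using IVT2'[of "\<lambda>s. det (matrix (\<lambda>v. v + s *\<^sub>R w' x v))" t 0 0] t(1) by fastforce
      then show False using nz by blast
    qed
    have hi: "((\<lambda>x. det (matrix (\<lambda>v. v + t *\<^sub>R w' x v))) has_integral (\<Sum>k\<le>CARD('n). b k * t ^ k)) B"
      unfolding c(1) b_def
      by (intro has_integral_sum has_integral_mult_left integrable_integral cint) auto
    have "measure lebesgue (F ` B) = integral B (\<lambda>x. \<bar>det (matrix (\<lambda>v. v + t *\<^sub>R w' x v))\<bar>)"
    proof (rule measure_differentiable_image_eq)
      show "B \<in> sets lebesgue" unfolding B_def by simp
      show "(F has_derivative (\<lambda>v. v + t *\<^sub>R w' x v)) (at x within B)" for x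
        using dF by (rule has_derivative_at_withinI)
      show "inj_on F B" using inj by (rule inj_on_subset) simp
      show "(\<lambda>x. \<bar>det (matrix (\<lambda>v. v + t *\<^sub>R w' x v))\<bar>) integrable_on B"
        using hi pos by (simp add: has_integral_integrable abs_of_pos)
    qed
    then show ?thesis using hi pos FB by (simp add: abs_of_pos integral_unique)
  qed
  have "b CARD('n) = 0"
  proof (rule ccontr)
    assume "b CARD('n) \<noteq> 0"
    \<comment> \<open>Subtracting the volume from the constant coefficient gives a polynomial that
      vanishes on the infinite set \<open>[0, 1/M)\<close>. Since \<open>CARD('n) > 0\<close>, its
      top coefficient is still \<open>b CARD('n)\<close>.\<close>
    define d where "d k = (if k = 0 then b 0 - measure lebesgue B else b k)" for k
    have "d CARD('n) \<noteq> 0" using \<open>b CARD('n) \<noteq> 0\<close> by (simp add: d_def)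
    then have fin: "finite {t. (\<Sum>k\<le>CARD('n). d k * t ^ k) = 0}"
      using polyfun_finite_roots[of d "CARD('n)"] by blast
    have "(\<Sum>k\<le>CARD('n). d k * t ^ k) = 0" if "t \<in> {0..<1 / M}" for t
    proof -
      have "d k * t ^ k = b k * t ^ k - (if k = 0 then measure lebesgue B else 0)" for k
        by (simp add: d_def)
      then have "(\<Sum>k\<le>CARD('n). d k * t ^ k) = (\<Sum>k\<le>CARD('n). b k * t ^ k) - measure lebesgue B"
        by (simp add: sum_subtractf)
      then show ?thesis using poly[of t] that M(1) by (simp add: pos_less_divide_eq)
    qed
    then have "{0..<1 / M} \<subseteq> {t. (\<Sum>k\<le>CARD('n). d k * t ^ k) = 0}" by blast
    then have "finite {0..<1 / M}" using fin finite_subset by blast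
    then show False using M(1) infinite_Ico[of 0 "1 / M"] by simp
  qed
  moreover have "((\<lambda>x. det (matrix (w' x))) has_integral b CARD('n)) B"
    using cint[of "CARD('n)"] unfolding b_def c(2)[symmetric] by (simp add: integrable_integral)
  ultimately have "((\<lambda>x. det (matrix (w' x))) has_integral 0) B" by simp
  moreover have "det (matrix (w' x)) = 0" if "x \<notin> B" for x
  proof -
    have "w' x = (\<lambda>v. 0)"
      by (rule C1_on_unique[OF w C1_on_const[of UNIV 0], of "- B"]) (use that supp a B_def in auto)
    then show ?thesis by (intro det_zero_row(1)) (simp add: matrix_def row_def vec_eq_iff)
  qed
  ultimately show ?thesis by (rule has_integral_on_superset) auto
qed

text \<open>Vanishing is asked only on \<open>T - S\<close>, since the integrands to be treated are
  not controlled outside \<open>T\<close>.\<close>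

lemma has_integral_superset_zero_diff:
  fixes f :: "'a::euclidean_space \<Rightarrow> 'b::banach"
  assumes "(f has_integral i) S" "S \<subseteq> T" "\<And>x. x \<in> T - S \<Longrightarrow> f x = 0"
  shows "(f has_integral i) T"
proof -
  have "(\<lambda>x. if x \<in> T then f x else 0) = (\<lambda>x. if x \<in> S then f x else 0)"
    using assms(2,3) by fastforce
  then show ?thesis using assms(1) has_integral_restrict_UNIV[of T f i] has_integral_restrict_UNIV[of S f i]
    by simp
qed

text \<open>The open sets \<open>V\<close> and \<open>- L\<close> cover the space. On the first the
  product rule applies, on the second the extension is identically 0; on the overlap uniqueness of
  the derivative reconciles the two formulas.\<close>

lemma C1_on_cutoff_extension:
  fixes G :: "'a::euclidean_space \<Rightarrow> 'b::real_normed_vector" and c :: "'a \<Rightarrow> real"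
  assumes G: "C1_on V G G'" and c: "C1_on UNIV c c'" and V: "open V"
    and L: "compact L" "L \<subseteq> V" "\<And>x. x \<notin> L \<Longrightarrow> c x = 0"
  shows "C1_on UNIV (\<lambda>x. if x \<in> V then c x *\<^sub>R G x else 0)
    (\<lambda>x v. if x \<in> V then c x *\<^sub>R G' x v + c' x v *\<^sub>R G x else 0)" (is "C1_on UNIV ?w ?w'")
proof -
  have W: "C1_on V (\<lambda>x. c x *\<^sub>R G x) (\<lambda>x v. c x *\<^sub>R G' x v + c' x v *\<^sub>R G x)"
    by (intro C1_on_scaleR G C1_on_subset[OF c]) simp
  have op: "open (- L)" using L(1) compact_imp_closed by blast
  have "C1_on V ?w ?w'" by (rule C1_on_transform[OF W V]) auto
  moreover have "C1_on (- L) ?w ?w'"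
  proof (rule C1_on_transform[OF C1_on_const[of _ 0] op])
    fix x assume x: "x \<in> - L"
    show "0 = ?w x" using L(3) x by simp
    show "(\<lambda>v. 0) = ?w' x"
    proof (cases "x \<in> V")
      case True
      then show ?thesis
        using C1_on_unique[OF C1_on_const[of UNIV 0] W, of "V \<inter> - L" x] V op x L(3) by auto
    qed simp
  qed
  moreover have "V \<union> - L = UNIV" using L(2) by auto
  ultimately show ?thesis using C1_on_Un[of V ?w ?w' "- L"] V op by simp
qed

text \<open>Multiply both maps by a cutoff that is 1 near \<open>K\<close>; each product has compact
  support and a Jacobian of integral 0. The difference of these Jacobians is the integrand: on
  \<open>K\<close> the cutoff is invisible, and off \<open>K\<close> both differences are 0. Only
  the difference is integrated because the two Jacobians are not assumed integrable over
  \<open>V\<close>.\<close>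

lemma integral_det_eq_of_eq_outside_compact:
  fixes G0 G1 :: "real^'n::{finite,wellorder} \<Rightarrow> real^'n::_"
  assumes G0: "C1_on V G0 G0'" and G1: "C1_on V G1 G1'" and V: "open V"
    and K: "compact K" "K \<subseteq> V" and eq: "\<And>x. x \<in> V - K \<Longrightarrow> G0 x = G1 x"
  shows "((\<lambda>x. det (matrix (G0' x)) - det (matrix (G1' x))) has_integral 0) V"
proof -
  obtain c :: "real^'n::_ \<Rightarrow> real" and c' N L where c: "C1_on UNIV c c'"
    and N: "open N" "K \<subseteq> N" "\<And>x. x \<in> N \<Longrightarrow> c x = 1"
    and L: "compact L" "L \<subseteq> V" "\<And>x. x \<notin> L \<Longrightarrow> c x = 0"
    by (rule C1_cutoff[OF K(1) V K(2)]) blast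
  define w where "w G x = (if x \<in> V then c x *\<^sub>R G x else 0)" for G :: "real^'n::_ \<Rightarrow> real^'n::_" and x
  define w' where "w' G G' x v = (if x \<in> V then c x *\<^sub>R G' x v + c' x v *\<^sub>R G x else 0)"
    for G :: "real^'n::_ \<Rightarrow> real^'n::_" and G' and x v :: "real^'n::_"
  have w: "C1_on UNIV (w G) (w' G G')" if "C1_on V G G'" for G G'
    unfolding w_def[abs_def] w'_def[abs_def] by (rule C1_on_cutoff_extension[OF that c V L])
  have zero: "((\<lambda>x. det (matrix (w' G G' x))) has_integral 0) UNIV" if "C1_on V G G'" for G G'
    by (rule integral_det_compact_support[OF w[OF that] L(1)]) (auto simp: w_def L(3))
  have wN: "w' G G' x = G' x" if "C1_on V G G'" "x \<in> V \<inter> N" for G G' x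
    by (rule C1_on_unique[OF w[OF that(1)] that(1), of "V \<inter> N"]) (use V N that in \<open>auto simp: w_def\<close>)
  have op: "open (V - K)" using V K(1) by (simp add: compact_imp_closed open_Diff)
  have *: "det (matrix (w' G0 G0' x)) - det (matrix (w' G1 G1' x)) =
      (if x \<in> V then det (matrix (G0' x)) - det (matrix (G1' x)) else 0)" for x
  proof (cases "x \<in> V")
    case False
    then have "w' G0 G0' x = w' G1 G1' x" by (simp add: w'_def fun_eq_iff)
    then show ?thesis using False by simp
  next
    case True
    show ?thesis
    proof (cases "x \<in> K")
      case True
      then have "x \<in> V \<inter> N" using N(2) K(2) by blast
      then show ?thesis using wN[OF G0] wN[OF G1] by simp
    next
      case False
      have x: "x \<in> V - K" using False True by simp
      have "G0' x = G1' x"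
        by (rule C1_on_unique[OF G0 G1 op x]) (use eq in auto)
      then have "w' G0 G0' x = w' G1 G1' x" using eq[OF x] by (simp add: w'_def fun_eq_iff)
      then show ?thesis using \<open>G0' x = G1' x\<close> by simp
    qed
  qed
  have "((\<lambda>x. det (matrix (w' G0 G0' x)) - det (matrix (w' G1 G1' x))) has_integral 0 - 0) UNIV"
    by (intro has_integral_diff zero G0 G1)
  then show ?thesis unfolding * by (simp add: has_integral_restrict_UNIV)
qed

section \<open>Bump functions on cubes and change of variables\<close>

text \<open>The Jacobian determinant of the map applying \<open>ramp d\<close> to every coordinate;
  for \<open>d > 0\<close> it is supported in the cube \<open>[-d, d]^n\<close>.\<close>

definition cube_bump :: "real \<Rightarrow> real^'n \<Rightarrow> real" where
  "cube_bump d y = (\<Prod>i\<in>UNIV. tent d (y $ i))"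

lemma cube_bump_nonneg: "0 \<le> d \<Longrightarrow> 0 \<le> cube_bump d y"
  unfolding cube_bump_def by (rule prod_nonneg) (simp add: tent_nonneg)

lemma cube_bump_norm:
  fixes y :: "real^'n"
  assumes "0 < d" "cube_bump d y \<noteq> 0"
  shows "norm y \<le> real CARD('n) * d" "y \<in> cbox (\<chi> i. - d) (\<chi> i. d)"
proof -
  have *: "\<bar>y $ i\<bar> \<le> d" for i
  proof (rule ccontr)
    assume "\<not> \<bar>y $ i\<bar> \<le> d"
    then have "tent d (y $ i) = 0" using assms(1) by (intro tent_eq_0) auto
    then show False using assms(2) unfolding cube_bump_def by (metis finite prod_zero_iff UNIV_I)
  qed
  have "norm y \<le> (\<Sum>i\<in>UNIV. \<bar>y $ i\<bar>)" by (rule norm_le_l1_cart)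
  also have "\<dots> \<le> (\<Sum>i\<in>(UNIV :: 'n set). d)" using * by (rule sum_mono)
  finally show "norm y \<le> real CARD('n) * d" by simp
  show "y \<in> cbox (\<chi> i. - d) (\<chi> i. d)"
    using * by (auto simp: mem_box_cart abs_le_iff minus_le_iff)
qed

lemma
  fixes W :: "(real^'n) set"
  assumes d: "0 < d"
  shows cube_bump_has_integral: "cbox (\<chi> i. - d) (\<chi> i. d) \<subseteq> W \<Longrightarrow>
      (cube_bump d has_integral integral UNIV (cube_bump d :: real^'n \<Rightarrow> real)) W"
    and integral_cube_bump_pos: "0 < integral UNIV (cube_bump d :: real^'n \<Rightarrow> real)"
proof -
  let ?B = "cbox (\<chi> i. - d) (\<chi> i. d) :: (real^'n) set"
  have cont: "continuous_on ?B (cube_bump d)"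
    unfolding cube_bump_def[abs_def] by (intro continuous_intros continuous_on_prod)
  have int: "(cube_bump d has_integral integral ?B (cube_bump d)) ?B"
    using integrable_continuous[OF cont] by (rule integrable_integral)
  have "integral ?B (cube_bump d) \<noteq> 0"
  proof
    assume 0: "integral ?B (cube_bump d) = 0"
    have "cube_bump d (0 :: real^'n) = 0"
    proof (rule has_integral_0_cbox_imp_0[OF cont])
      show "(cube_bump d has_integral 0) ?B" using int 0 by simp
      have "(0 :: real^'n) \<in> box (\<chi> i. - d) (\<chi> i. d)" using d by (simp add: mem_box_cart)
      then show "box (\<chi> i. - d) (\<chi> i. d) \<noteq> ({} :: (real^'n) set)" by blast
    qed (use d in \<open>auto simp: mem_box_cart intro: cube_bump_nonneg\<close>)
    moreover have "0 < cube_bump d (0 :: real^'n)"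
      unfolding cube_bump_def using d by (intro prod_pos) (auto intro: tent_pos)
    ultimately show False by simp
  qed
  moreover have "0 \<le> integral ?B (cube_bump d)"
    by (rule has_integral_nonneg[OF int]) (use d in \<open>simp add: cube_bump_nonneg\<close>)
  ultimately have pos: "0 < integral ?B (cube_bump d)" by linarith
  have sup: "(cube_bump d has_integral integral ?B (cube_bump d)) T" if "?B \<subseteq> T" for T
    by (rule has_integral_on_superset[OF int _ that]) (use cube_bump_norm(2)[OF d] in blast)
  have eq: "integral UNIV (cube_bump d :: real^'n \<Rightarrow> real) = integral ?B (cube_bump d)"
    using sup[of UNIV] by (simp add: integral_unique)
  show "cbox (\<chi> i. - d) (\<chi> i. d) \<subseteq> W \<Longrightarrow> (cube_bump d has_integral integral UNIV (cube_bump d :: real^'n \<Rightarrow> real)) W"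
    unfolding eq by (rule sup)
  show "0 < integral UNIV (cube_bump d :: real^'n \<Rightarrow> real)" unfolding eq by (rule pos)
qed

lemma det_matrix_componentwise_scale:
  fixes A :: "real^'n \<Rightarrow> real^'n"
  shows "det (matrix (\<lambda>v. \<chi> i. a i * A v $ i)) = (\<Prod>i\<in>UNIV. a i) * det (matrix A)"
proof -
  have "matrix (\<lambda>v. \<chi> i. a i * A v $ i) = (\<chi> i. a i *s (\<chi> j. A (axis j 1) $ i))"
    by (simp add: matrix_def vec_eq_iff)
  then show ?thesis by (simp add: det_rows_mul matrix_def)
qed

lemma C1_on_ramp_compose:
  fixes u :: "'a::euclidean_space \<Rightarrow> real^'n"
  assumes "C1_on S u u'"
  shows "C1_on S (\<lambda>x. \<chi> i. ramp d (u x $ i)) (\<lambda>x v. \<chi> i. tent d (u x $ i) * u' x v $ i)"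
proof (rule C1_on_vec_lambda)
  have "continuous_on UNIV (tent d)" by (intro continuous_on_tent continuous_on_id)
  then show "C1_on S (\<lambda>x. ramp d (u x $ i)) (\<lambda>x v. tent d (u x $ i) * u' x v $ i)" for i
    by (rule C1_on_compose_real[OF C1_on_vec_nth[OF assms] ramp_derivative])
qed

text \<open>The formula for vector-valued integrands, applied to values in \<open>real^1\<close> and
  read back through \<open>vec\<close>.\<close>

lemma has_absolute_integral_change_of_variables_scalar:
  fixes f :: "real^'m::{finite,wellorder} \<Rightarrow> real" and g :: "real^'m::_ \<Rightarrow> real^'m::_"
  assumes S: "S \<in> sets lebesgue"
    and der_g: "\<And>x. x \<in> S \<Longrightarrow> (g has_derivative g' x) (at x within S)"
    and inj: "inj_on g S"
  shows "(\<lambda>x. \<bar>det (matrix (g' x))\<bar> * f (g x)) absolutely_integrable_on S \<and>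
           integral S (\<lambda>x. \<bar>det (matrix (g' x))\<bar> * f (g x)) = b
     \<longleftrightarrow> f absolutely_integrable_on (g ` S) \<and> integral (g ` S) f = b"
proof -
  have "(\<lambda>x. \<bar>det (matrix (g' x))\<bar> *\<^sub>R vec (f (g x)) :: real ^ 1) absolutely_integrable_on S \<and>
           integral S (\<lambda>x. \<bar>det (matrix (g' x))\<bar> *\<^sub>R vec (f (g x))) = (vec b :: real ^ 1)
         \<longleftrightarrow> (\<lambda>x. vec (f x) :: real ^ 1) absolutely_integrable_on (g ` S) \<and>
           integral (g ` S) (\<lambda>x. vec (f x)) = (vec b :: real ^ 1)"
    by (rule has_absolute_integral_change_of_variables[OF assms])
  then show ?thesis by (simp add: absolutely_integrable_on_1_iff integral_on_1_eq)
qed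

section \<open>Regular zeros and their signs\<close>

text \<open>The inverse function theorem is applied on the open set \<open>O'\<close> where the
  Jacobian has the same sign as at \<open>a\<close>, so the sign is constant on \<open>U\<close> by
  construction.\<close>

lemma C1_local_diffeo:
  fixes u :: "real^'n \<Rightarrow> real^'n"
  assumes u: "C1_on V u u'" and V: "open V" "a \<in> V" and a: "det (matrix (u' a)) \<noteq> 0"
  obtains U W where "open U" "a \<in> U" "U \<subseteq> V" "open W" "u ` U = W" "inj_on u U"
    "\<And>x. x \<in> U \<Longrightarrow> sgn (det (matrix (u' x))) = sgn (det (matrix (u' a)))"
proof -
  define s where "s = sgn (det (matrix (u' a)))"
  define O' where "O' = V \<inter> (\<lambda>x. s * det (matrix (u' x))) -` {0<..}"
  have "continuous_on V (\<lambda>x. s * det (matrix (u' x)))"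
    by (intro continuous_intros continuous_on_det_matrix C1_on_D(2)[OF u])
  then have O': "open O'" unfolding O'_def using V(1) by (intro continuous_open_preimage) auto
  have "a \<in> O'" using V(2) a by (auto simp: O'_def s_def sgn_if)
  have bl: "bounded_linear (u' x)" if "x \<in> O'" for x
    using C1_on_D(1)[OF u, of x] that has_derivative_bounded_linear unfolding O'_def by blast
  define D where "D x = Blinfun (u' x)" for x
  have D: "blinfun_apply (D x) = u' x" if "x \<in> O'" for x
    unfolding D_def using bl[OF that] by (rule bounded_linear_Blinfun_apply)
  have lin: "linear (u' a)" using C1_on_linear[OF u V(2)] .
  then have "inj (u' a)" using a det_nz_iff_inj by blast
  then obtain g where g: "linear g" "g \<circ> u' a = id"
    using linear_injective_left_inverse[OF lin] by blast
  define G where "G = Blinfun g"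
  have G: "blinfun_apply G = g"
    unfolding G_def using g(1) by (intro bounded_linear_Blinfun_apply) (simp add: linear_conv_bounded_linear)
  have "G o\<^sub>L D a = id_blinfun"
    by (rule blinfun_eqI) (use G D[OF \<open>a \<in> O'\<close>] g(2) in \<open>simp add: fun_eq_iff\<close>)
  moreover have "(u has_derivative blinfun_apply (D x)) (at x)" if "x \<in> O'" for x
    using C1_on_D(1)[OF u, of x] that D by (simp add: O'_def)
  moreover have "continuous_on O' D"
  proof (rule continuous_on_blinfun_componentwise)
    fix i :: "real^'n"
    have "continuous_on O' (\<lambda>x. u' x i)"
      by (rule continuous_on_subset[OF C1_on_D(2)[OF u]]) (auto simp: O'_def)
    then show "continuous_on O' (\<lambda>x. blinfun_apply (D x) i)" by (simp add: D cong: continuous_on_cong)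
  qed
  ultimately obtain U W h h' where U: "open U" "U \<subseteq> O'" "a \<in> U" "open W" "homeomorphism U W u h"
    using inverse_function_theorem[OF O' _ _ \<open>a \<in> O'\<close>, of u D G] by metis
  show thesis
  proof
    show "open U" "a \<in> U" "open W" by fact+
    show "U \<subseteq> V" using U(2) by (auto simp: O'_def)
    show "u ` U = W" using U(5) by (rule homeomorphism_image1)
    show "inj_on u U" by (rule inj_on_inverseI) (rule homeomorphism_apply1[OF U(5)])
    show "sgn (det (matrix (u' x))) = sgn (det (matrix (u' a)))" if "x \<in> U" for x
    proof -
      have "s = 1 \<or> s = -1" using a by (auto simp: s_def sgn_if)
      moreover have "0 < s * det (matrix (u' x))" using that U(2) by (auto simp: O'_def)
      ultimately show ?thesis unfolding s_def[symmetric] by (auto simp: sgn_if)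
    qed
  qed
qed

text \<open>Without zeros on the frontier, the zeros in \<open>V\<close> are those in the compact
  closure, so they form a compact set. Each of them is isolated by local injectivity.\<close>

lemma finite_regular_zeros:
  fixes u :: "real^'n \<Rightarrow> real^'n"
  assumes V: "open V" "bounded V" and cont: "continuous_on (closure V) u" and u: "C1_on V u u'"
    and fr: "\<And>x. x \<in> frontier V \<Longrightarrow> u x \<noteq> 0"
    and reg: "\<And>x. x \<in> V \<Longrightarrow> u x = 0 \<Longrightarrow> det (matrix (u' x)) \<noteq> 0"
  shows "finite {x \<in> V. u x = 0}"
proof -
  let ?Z = "{x \<in> V. u x = 0}"
  have "?Z = closure V \<inter> u -` {0}"
    using fr V(1) closure_subset[of V] by (auto simp: frontier_def interior_open)
  moreover have "closed (closure V \<inter> u -` {0})"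
    by (rule continuous_closed_preimage[OF cont]) auto
  ultimately have comp: "compact ?Z"
    using bounded_subset[OF V(2), of ?Z] by (auto simp: compact_eq_bounded_closed)
  have "\<exists>U. open U \<and> a \<in> U \<and> U \<inter> ?Z \<subseteq> {a}" if a: "a \<in> ?Z" for a
  proof -
    from a have "a \<in> V" "det (matrix (u' a)) \<noteq> 0" using reg by auto
    then obtain U where "open U" "a \<in> U" "inj_on u U"
      using C1_local_diffeo[OF u V(1)] by metis
    moreover have "U \<inter> ?Z \<subseteq> {a}"
      using inj_onD[OF \<open>inj_on u U\<close>, of _ a] \<open>a \<in> U\<close> a by auto
    ultimately show ?thesis by blast
  qed
  then have "\<forall>a\<in>?Z. \<exists>U. open U \<and> a \<in> U \<and> U \<inter> ?Z \<subseteq> {a}" ..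
  from bchoice[OF this] obtain U
    where U: "\<And>a. a \<in> ?Z \<Longrightarrow> open (U a) \<and> a \<in> U a \<and> U a \<inter> ?Z \<subseteq> {a}" by blast
  obtain I where I: "I \<subseteq> ?Z" "finite I" "?Z \<subseteq> (\<Union>a\<in>I. U a)"
  proof (rule compactE_image[OF comp])
    show "open (U a)" if "a \<in> ?Z" for a using U[OF that] by simp
    show "?Z \<subseteq> (\<Union>a\<in>?Z. U a)" using U by blast
  qed
  have "?Z \<subseteq> I" using I U by blast
  then show ?thesis using I(2) finite_subset by blast
qed

text \<open>The Jacobian of the composition of \<open>u\<close> with \<open>y \<mapsto> (ramp d y\<^sub>i)\<^sub>i\<close> is \<open>cube_bump d (u x) det (u' x)\<close>;
  for small \<open>d\<close> it is supported near the zeros of \<open>u\<close>, each of which contributes its sign.\<close>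

lemma integral_det_ramp_compose:
  fixes u :: "real^'n::{finite,wellorder} \<Rightarrow> real^'n::_"
  assumes V: "open V" "bounded V" and cont: "continuous_on (closure V) u" and u: "C1_on V u u'"
    and fr: "\<And>x. x \<in> frontier V \<Longrightarrow> u x \<noteq> 0"
    and reg: "\<And>x. x \<in> V \<Longrightarrow> u x = 0 \<Longrightarrow> det (matrix (u' x)) \<noteq> 0"
  shows "\<exists>D>0. \<forall>d. 0 < d \<and> d < D \<longrightarrow>
      ((\<lambda>x. det (matrix (\<lambda>v. \<chi> i. tent d (u x $ i) * u' x v $ i)))
        has_integral (\<Sum>x | x \<in> V \<and> u x = 0. sgn (det (matrix (u' x)))) *
          integral UNIV (cube_bump d :: real^'n::_ \<Rightarrow> real)) V"
proof -
  define Z where "Z = {x \<in> V. u x = 0}"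
  have finZ: "finite Z" unfolding Z_def by (rule finite_regular_zeros[OF assms])
  \<comment> \<open>\<open>r a\<close> bounds the distance from \<open>a\<close> to the other zeros
    from below, so the balls of radius \<open>r a / 2\<close> around distinct zeros are
    disjoint.\<close>
  then have "\<forall>a. \<exists>r>0. \<forall>b\<in>Z. b \<noteq> a \<longrightarrow> r \<le> dist a b" using finite_set_avoid by blast
  then obtain r where r: "\<And>a. 0 < r a" "\<And>a b. b \<in> Z \<Longrightarrow> b \<noteq> a \<Longrightarrow> r a \<le> dist a b" by metis
  have "\<exists>U. open U \<and> a \<in> U \<and> U \<subseteq> V \<inter> ball a (r a / 2) \<and> open (u ` U) \<and> inj_on u U \<and>
      (\<forall>x\<in>U. sgn (det (matrix (u' x))) = sgn (det (matrix (u' a))))" if a: "a \<in> Z" for a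
  proof -
    have "C1_on (V \<inter> ball a (r a / 2)) u u'" using u by (rule C1_on_subset) auto
    moreover have "open (V \<inter> ball a (r a / 2))" "a \<in> V \<inter> ball a (r a / 2)"
      using V(1) r a by (auto simp: Z_def)
    moreover have "det (matrix (u' a)) \<noteq> 0" using a reg by (auto simp: Z_def)
    ultimately show ?thesis by (rule C1_local_diffeo) blast
  qed
  then have "\<forall>a\<in>Z. \<exists>U. open U \<and> a \<in> U \<and> U \<subseteq> V \<inter> ball a (r a / 2) \<and> open (u ` U) \<and> inj_on u U \<and>
      (\<forall>x\<in>U. sgn (det (matrix (u' x))) = sgn (det (matrix (u' a))))" ..
  from bchoice[OF this] obtain U
    where U0: "\<forall>a\<in>Z. open (U a) \<and> a \<in> U a \<and> U a \<subseteq> V \<inter> ball a (r a / 2) \<and>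
      open (u ` U a) \<and> inj_on u (U a) \<and>
      (\<forall>x\<in>U a. sgn (det (matrix (u' x))) = sgn (det (matrix (u' a))))" ..
  have U: "open (U a)" "a \<in> U a" "U a \<subseteq> V" "U a \<subseteq> ball a (r a / 2)" "open (u ` U a)" "inj_on u (U a)"
    "\<And>x. x \<in> U a \<Longrightarrow> sgn (det (matrix (u' x))) = sgn (det (matrix (u' a)))" if "a \<in> Z" for a
    using bspec[OF U0 that] by blast+
  have disj: "U a \<inter> U b = {}" if ab: "a \<in> Z" "b \<in> Z" "a \<noteq> b" for a b
  proof (rule ccontr)
    assume "U a \<inter> U b \<noteq> {}"
    then obtain x where "x \<in> ball a (r a / 2)" "x \<in> ball b (r b / 2)" using U(4)[OF ab(1)] U(4)[OF ab(2)] by blast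
    then have "dist a b < r a / 2 + r b / 2"
      using dist_triangle_less_add[of a x "r a / 2" b "r b / 2"] by (auto simp: dist_commute)
    moreover have "r a \<le> dist a b" "r b \<le> dist a b" using r(2)[of b a] r(2)[of a b] ab by (auto simp: dist_commute)
    ultimately show False by linarith
  qed
  \<comment> \<open>On the compact set \<open>C\<close> the map \<open>u\<close> has no zero and
    keeps a distance \<open>m\<close> from 0. Once the cube lies inside the ball of radius
    \<open>m\<close>, the integrand vanishes on \<open>C\<close>.\<close>
  define C where "C = closure V - (\<Union>a\<in>Z. U a)"
  have "compact (closure V)" using V(2) by (simp add: compact_closure)
  moreover have "open (\<Union>a\<in>Z. U a)" using U(1) by blast
  ultimately have "compact C" unfolding C_def by (rule compact_diff)
  moreover have "continuous_on C u" using cont by (rule continuous_on_subset) (auto simp: C_def)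
  ultimately have "closed (u ` C)" by (simp add: compact_continuous_image compact_imp_closed)
  moreover have "0 \<notin> u ` C"
  proof
    assume "0 \<in> u ` C"
    then obtain x where x: "x \<in> C" "u x = 0" by force
    then have "x \<in> V" using fr V(1) by (auto simp: C_def frontier_def interior_open)
    then show False using x U(2)[of x] by (auto simp: C_def Z_def)
  qed
  ultimately obtain m where m: "0 < m" "\<And>y. y \<in> u ` C \<Longrightarrow> m \<le> dist 0 y"
    using separate_point_closed by metis
  have "open (\<Inter>a\<in>Z. u ` U a)" using finZ U(5) by (intro open_INT) auto
  moreover have "0 \<in> (\<Inter>a\<in>Z. u ` U a)" using U(2) by (force simp: Z_def)
  ultimately obtain e where e: "0 < e" "cball 0 e \<subseteq> (\<Inter>a\<in>Z. u ` U a)"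
    using open_contains_cball by metis
  show ?thesis
  proof (intro exI[of _ "min m e / (CARD('n) + 1)"] conjI allI impI)
    show "0 < min m e / (CARD('n) + 1)" using m(1) e(1) by simp
    fix d assume d': "0 < d \<and> d < min m e / (CARD('n) + 1)"
    then have d: "0 < d" "d < min m e / (CARD('n) + 1)" by auto
    define J where "J = integral UNIV (cube_bump d :: real^'n::_ \<Rightarrow> real)"
    have dn: "real CARD('n) * d < min m e"
    proof -
      have "real CARD('n) * d \<le> d * (CARD('n) + 1)" using d(1) by (simp add: algebra_simps)
      also have "\<dots> < min m e" using d(2) by (simp add: pos_less_divide_eq)
      finally show ?thesis .
    qed
    have norm_cube: "norm y \<le> real CARD('n) * d" if y: "y \<in> cbox (\<chi> i. - d) (\<chi> i. d)" for y :: "real^'n::_"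
    proof -
      have "norm y \<le> (\<Sum>i\<in>UNIV. \<bar>y $ i\<bar>)" by (rule norm_le_l1_cart)
      also have "\<dots> \<le> (\<Sum>i\<in>(UNIV :: 'n set). d)"
        using y by (intro sum_mono) (auto simp: mem_box_cart abs_le_iff minus_le_iff)
      finally show ?thesis by simp
    qed
    let ?F = "\<lambda>x. cube_bump d (u x) * det (matrix (u' x))"
    have F: "det (matrix (\<lambda>v. \<chi> i. tent d (u x $ i) * u' x v $ i)) = ?F x" for x
      by (simp add: det_matrix_componentwise_scale cube_bump_def)
    have local: "(?F has_integral sgn (det (matrix (u' a))) * J) (U a)" if a: "a \<in> Z" for a
    proof -
      have "cbox (\<chi> i. - d) (\<chi> i. d) \<subseteq> u ` U a"
        using norm_cube dn e(2) a by (force simp: subset_iff)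
      then have "(cube_bump d has_integral J) (u ` U a)"
        unfolding J_def by (rule cube_bump_has_integral[OF d(1)])
      moreover from this have "cube_bump d absolutely_integrable_on u ` U a"
        using d(1) by (intro nonnegative_absolutely_integrable_1) (auto intro: cube_bump_nonneg)
      ultimately have "cube_bump d absolutely_integrable_on u ` U a \<and> integral (u ` U a) (cube_bump d) = J"
        by (simp add: integral_unique)
      moreover have "U a \<in> sets lebesgue" using U(1)[OF a] by (simp add: borel_open)
      moreover have "(u has_derivative u' x) (at x within U a)" if "x \<in> U a" for x
        using C1_on_D(1)[OF u] U(3)[OF a] that has_derivative_at_withinI by blast
      ultimately have *: "(\<lambda>x. \<bar>det (matrix (u' x))\<bar> * cube_bump d (u x)) absolutely_integrable_on U a \<and>
          integral (U a) (\<lambda>x. \<bar>det (matrix (u' x))\<bar> * cube_bump d (u x)) = J"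
        using has_absolute_integral_change_of_variables_scalar[of "U a" u u' "cube_bump d" J] U(6)[OF a] by blast
      then have "((\<lambda>x. \<bar>det (matrix (u' x))\<bar> * cube_bump d (u x)) has_integral J) (U a)"
        using set_lebesgue_integral_eq_integral(1) by (metis integrable_integral)
      \<comment> \<open>The sign of the Jacobian is constant on \<open>U a\<close>, so multiplying
        by it turns the absolute value into the determinant itself.\<close>
      from has_integral_mult_right[OF this, of "sgn (det (matrix (u' a)))"]
      show ?thesis
      proof (rule has_integral_eq[rotated])
        fix x assume "x \<in> U a"
        then have "sgn (det (matrix (u' a))) = sgn (det (matrix (u' x)))" using U(7)[OF a] by simp
        then show "sgn (det (matrix (u' a))) * (\<bar>det (matrix (u' x))\<bar> * cube_bump d (u x)) = ?F x"
          by (simp add: sgn_if abs_if)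
      qed
    qed
    have "(?F has_integral (\<Sum>a\<in>Z. sgn (det (matrix (u' a))) * J)) (\<Union>a\<in>Z. U a)"
      using local disj by (intro has_integral_UN finZ) (auto simp: pairwise_def)
    then have "(?F has_integral (\<Sum>a\<in>Z. sgn (det (matrix (u' a))) * J)) V"
    proof (rule has_integral_superset_zero_diff)
      show "(\<Union>a\<in>Z. U a) \<subseteq> V" using U(3) by blast
      fix x assume x: "x \<in> V - (\<Union>a\<in>Z. U a)"
      then have "x \<in> C" using closure_subset[of V] by (auto simp: C_def)
      then have "m \<le> norm (u x)" using m(2)[of "u x"] by simp
      then have "cube_bump d (u x) = 0" using cube_bump_norm(1)[OF d(1), of "u x"] dn by force
      then show "?F x = 0" by simp
    qed
    then show "((\<lambda>x. det (matrix (\<lambda>v. \<chi> i. tent d (u x $ i) * u' x v $ i)))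
        has_integral (\<Sum>x | x \<in> V \<and> u x = 0. sgn (det (matrix (u' x)))) *
          integral UNIV (cube_bump d :: real^'n::_ \<Rightarrow> real)) V"
      unfolding F by (simp add: Z_def J_def sum_distrib_right)
  qed
qed

section \<open>Homotopy invariance of the sum of signs\<close>

text \<open>Take one \<open>d\<close> small enough for both maps. Their compositions with the ramps
  still agree outside \<open>K\<close>, so the two Jacobian integrals coincide, and the positive
  integral of the bump cancels.\<close>

lemma sum_sgn_det_eq_of_eq_outside_compact:
  fixes u0 u1 :: "real^'n::{finite,wellorder} \<Rightarrow> real^'n::_"
  assumes V: "open V" "bounded V"
    and cont: "continuous_on (closure V) u0" "continuous_on (closure V) u1"
    and u: "C1_on V u0 u0'" "C1_on V u1 u1'"
    and fr: "\<And>x. x \<in> frontier V \<Longrightarrow> u0 x \<noteq> 0" "\<And>x. x \<in> frontier V \<Longrightarrow> u1 x \<noteq> 0"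
    and reg: "\<And>x. x \<in> V \<Longrightarrow> u0 x = 0 \<Longrightarrow> det (matrix (u0' x)) \<noteq> 0"
      "\<And>x. x \<in> V \<Longrightarrow> u1 x = 0 \<Longrightarrow> det (matrix (u1' x)) \<noteq> 0"
    and K: "compact K" "K \<subseteq> V" and eq: "\<And>x. x \<in> V - K \<Longrightarrow> u0 x = u1 x"
  shows "(\<Sum>x | x \<in> V \<and> u0 x = 0. sgn (det (matrix (u0' x)))) =
    (\<Sum>x | x \<in> V \<and> u1 x = 0. sgn (det (matrix (u1' x))))" (is "?N0 = ?N1")
proof -
  let ?J = "\<lambda>d. integral UNIV (cube_bump d :: real^'n::_ \<Rightarrow> real)"
  obtain D0 where D0: "0 < D0" "\<forall>d. 0 < d \<and> d < D0 \<longrightarrow>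
      ((\<lambda>x. det (matrix (\<lambda>v. \<chi> i. tent d (u0 x $ i) * u0' x v $ i))) has_integral ?N0 * ?J d) V"
    using integral_det_ramp_compose[OF V cont(1) u(1) fr(1) reg(1)] by blast
  obtain D1 where D1: "0 < D1" "\<forall>d. 0 < d \<and> d < D1 \<longrightarrow>
      ((\<lambda>x. det (matrix (\<lambda>v. \<chi> i. tent d (u1 x $ i) * u1' x v $ i))) has_integral ?N1 * ?J d) V"
    using integral_det_ramp_compose[OF V cont(2) u(2) fr(2) reg(2)] by blast
  define d where "d = min D0 D1 / 2"
  have d: "0 < d" "d < D0" "d < D1" using D0(1) D1(1) by (auto simp: d_def)
  have "((\<lambda>x. det (matrix (\<lambda>v. \<chi> i. tent d (u0 x $ i) * u0' x v $ i)) -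
      det (matrix (\<lambda>v. \<chi> i. tent d (u1 x $ i) * u1' x v $ i))) has_integral ?N0 * ?J d - ?N1 * ?J d) V"
    using D0(2) D1(2) d by (intro has_integral_diff) simp_all
  moreover have "((\<lambda>x. det (matrix (\<lambda>v. \<chi> i. tent d (u0 x $ i) * u0' x v $ i)) -
      det (matrix (\<lambda>v. \<chi> i. tent d (u1 x $ i) * u1' x v $ i))) has_integral 0) V"
    by (rule integral_det_eq_of_eq_outside_compact[OF C1_on_ramp_compose[OF u(1)]
          C1_on_ramp_compose[OF u(2)] V(1) K]) (simp add: eq)
  ultimately have "?N0 * ?J d - ?N1 * ?J d = 0" by (rule has_integral_unique)
  then show ?thesis using integral_cube_bump_pos[OF d(1), where 'n = 'n] by simp
qed

lemma sum_sgn_det_homotopy_wellorder: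
  fixes h0 h1 :: "real^'n::{finite,wellorder} \<Rightarrow> real^'n::_"
  assumes V: "open V" "bounded V"
    and cont: "continuous_on (closure V) h0" "continuous_on (closure V) h1"
    and h: "C1_on V h0 h0'" "C1_on V h1 h1'"
    and fr: "\<And>x t. x \<in> frontier V \<Longrightarrow> 0 \<le> t \<Longrightarrow> t \<le> 1 \<Longrightarrow> h0 x + t *\<^sub>R (h1 x - h0 x) \<noteq> 0"
    and reg: "\<And>x. x \<in> V \<Longrightarrow> h0 x = 0 \<Longrightarrow> det (matrix (h0' x)) \<noteq> 0"
      "\<And>x. x \<in> V \<Longrightarrow> h1 x = 0 \<Longrightarrow> det (matrix (h1' x)) \<noteq> 0"
  shows "(\<Sum>x | x \<in> V \<and> h0 x = 0. sgn (det (matrix (h0' x)))) =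
    (\<Sum>x | x \<in> V \<and> h1 x = 0. sgn (det (matrix (h1' x))))"
proof -
  let ?T = "{p \<in> closure V \<times> {0..1::real}. h0 (fst p) + snd p *\<^sub>R (h1 (fst p) - h0 (fst p)) = 0}"
  \<comment> \<open>The points that are a zero of the segment at some time. As the projection of a
    compact set \<open>C\<close> is compact, and the frontier hypothesis places it inside
    \<open>V\<close>.\<close>
  define C where "C = fst ` ?T"
  have cl: "compact (closure V \<times> {0..1::real})" using V(2) by (intro compact_Times) auto
  have ct: "continuous_on (closure V \<times> {0..1::real}) (\<lambda>p. h0 (fst p) + snd p *\<^sub>R (h1 (fst p) - h0 (fst p)))"
    by (intro continuous_intros continuous_on_compose2[OF cont(1)] continuous_on_compose2[OF cont(2)]) auto
  have "closed ?T"
    using continuous_closed_preimage[OF ct compact_imp_closed[OF cl], of "{0}"]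
    by (simp add: vimage_def Int_def)
  then have "compact ?T"
    using bounded_subset[OF compact_imp_bounded[OF cl], of ?T] by (auto simp: compact_eq_bounded_closed)
  then have "compact C" unfolding C_def by (intro compact_continuous_image continuous_intros)
  have CI: "x \<in> C" if "x \<in> closure V" "0 \<le> t" "t \<le> 1" "h0 x + t *\<^sub>R (h1 x - h0 x) = 0" for x t
    unfolding C_def using that by (intro image_eqI[of _ _ "(x, t)"]) auto
  have "C \<subseteq> V"
  proof
    fix x assume "x \<in> C"
    then obtain t where "x \<in> closure V" "0 \<le> t" "t \<le> 1" "h0 x + t *\<^sub>R (h1 x - h0 x) = 0"
      unfolding C_def by auto
    then show "x \<in> V" using fr V(1) by (auto simp: frontier_def interior_open)
  qed
  obtain c :: "real^'n::_ \<Rightarrow> real" and c' N L where c: "C1_on UNIV c c'" "\<And>x. 0 \<le> c x" "\<And>x. c x \<le> 1"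
    and N: "open N" "C \<subseteq> N" "\<And>x. x \<in> N \<Longrightarrow> c x = 1"
    and L: "compact L" "L \<subseteq> V" "\<And>x. x \<notin> L \<Longrightarrow> c x = 0"
    by (rule C1_cutoff[OF \<open>compact C\<close> V(1) \<open>C \<subseteq> V\<close>]) blast
  define u where "u x = h0 x + c x *\<^sub>R (h1 x - h0 x)" for x
  define u' where "u' x v = h0' x v + (c x *\<^sub>R (h1' x v - h0' x v) + c' x v *\<^sub>R (h1 x - h0 x))" for x v
  have u: "C1_on V u u'"
    unfolding u_def[abs_def] u'_def[abs_def] by (intro C1_on_add C1_on_scaleR C1_on_diff h C1_on_subset[OF c(1)]) simp
  have ucont: "continuous_on (closure V) u"
    unfolding u_def[abs_def]
    by (intro continuous_intros cont continuous_on_subset[OF C1_on_continuous_on[OF c(1)]]) simp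
  \<comment> \<open>A zero of \<open>u\<close> is a zero of the segment at time \<open>c x\<close>,
    which lies in \<open>[0, 1]\<close>; so it belongs to \<open>C\<close>, where
    \<open>c = 1\<close> and \<open>u = h1\<close>. A zero of \<open>h1\<close> belongs to
    \<open>C\<close> through time 1.\<close>
  have zero_iff: "u x = 0 \<longleftrightarrow> h1 x = 0" if x: "x \<in> V" for x
  proof -
    have xcl: "x \<in> closure V" using x closure_subset by blast
    have "c x = 1" if "u x = 0"
      using CI[OF xcl c(2,3)] N that by (auto simp: u_def)
    moreover have "c x = 1" if "h1 x = 0"
      using CI[OF xcl, of 1] N that by auto
    ultimately show ?thesis by (auto simp: u_def)
  qed
  have der: "u' x = h1' x" if x: "x \<in> V" "h1 x = 0" for x
  proof -
    have "x \<in> N" using CI[of x 1] x closure_subset N(2) by auto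
    then show ?thesis
      using C1_on_unique[OF u h(2), of "V \<inter> N" x] V(1) N x by (auto simp: u_def)
  qed
  have "(\<Sum>x | x \<in> V \<and> h0 x = 0. sgn (det (matrix (h0' x)))) =
    (\<Sum>x | x \<in> V \<and> u x = 0. sgn (det (matrix (u' x))))"
  proof (rule sum_sgn_det_eq_of_eq_outside_compact[OF V cont(1) ucont h(1) u _ _ reg(1) _ L(1,2)])
    show "h0 x \<noteq> 0" "u x \<noteq> 0" if "x \<in> frontier V" for x
      using fr[OF that, of 0] fr[OF that, of "c x"] c by (auto simp: u_def)
    show "det (matrix (u' x)) \<noteq> 0" if "x \<in> V" "u x = 0" for x
      using that zero_iff der reg(2) by simp
    show "h0 x = u x" if "x \<in> V - L" for x using that L(3) by (simp add: u_def)
  qed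
  also have "\<dots> = (\<Sum>x | x \<in> V \<and> h1 x = 0. sgn (det (matrix (h1' x))))"
    by (rule sum.cong) (use zero_iff der in auto)
  finally show ?thesis .
qed

section \<open>Index types without a well-order\<close>

text \<open>Sard's theorem and the change of variables theorem of the library require a well-ordered index
  type, whereas \<open>'n\<close> is merely finite. Hence a well-ordered copy of the index type.\<close>

typedef 'a wo = "UNIV :: 'a set" morphisms of_wo to_wo by simp

lemma bij_of_wo: "bij of_wo"
  by (rule o_bij[of to_wo]) (auto simp: fun_eq_iff of_wo_inverse to_wo_inverse)

instance wo :: (finite) finite
proof
  have "(UNIV :: 'a wo set) = to_wo ` UNIV"
    using of_wo_inverse by (metis UNIV_I surjI surj_def)
  then show "finite (UNIV :: 'a wo set)" by (metis finite finite_imageI)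
qed

instantiation wo :: (finite) wellorder
begin

definition less_eq_wo :: "'a wo \<Rightarrow> 'a wo \<Rightarrow> bool" where
  "x \<le> y \<longleftrightarrow> to_nat (of_wo x) \<le> to_nat (of_wo y)"

definition less_wo :: "'a wo \<Rightarrow> 'a wo \<Rightarrow> bool" where
  "x < y \<longleftrightarrow> to_nat (of_wo x) < to_nat (of_wo y)"

instance
proof
  fix P :: "'a wo \<Rightarrow> bool" and a
  assume step: "\<And>x. (\<And>y. y < x \<Longrightarrow> P y) \<Longrightarrow> P x"
  show "P a"
  proof (induction "to_nat (of_wo a)" arbitrary: a rule: less_induct)
    case less
    then show ?case using step unfolding less_wo_def by blast
  qed
qed (auto simp: less_eq_wo_def less_wo_def of_wo_inject)

end

text \<open>Precomposition with \<open>s\<close>, a vector being a function of its index; hence the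
  direction of the map is opposite to that of \<open>s\<close>.\<close>

definition reindex :: "('m \<Rightarrow> 'n) \<Rightarrow> real^'n \<Rightarrow> real^'m" where
  "reindex s x = (\<chi> i. x $ s i)"

lemma linear_reindex: "linear (reindex s)"
  by (rule linearI) (simp_all add: reindex_def vec_eq_iff)

lemma reindex_inv: "bij s \<Longrightarrow> reindex s (reindex (inv s) x) = x" "bij s \<Longrightarrow> reindex (inv s) (reindex s y) = y"
  by (simp_all add: reindex_def vec_eq_iff bij_is_inj bij_is_surj surj_f_inv_f)

text \<open>The two matrices have different index types, so the Leibniz sums are matched term by
  term: conjugation by \<open>s\<close> is a bijection of the permutations that preserves the
  sign.\<close>

lemma det_matrix_reindex:
  fixes A :: "real^'n \<Rightarrow> real^'n" and s :: "'m::finite \<Rightarrow> 'n::finite"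
  assumes s: "bij s"
  shows "det (matrix (\<lambda>v. reindex s (A (reindex (inv s) v)))) = det (matrix A)"
proof -
  have ax: "reindex (inv s) (axis j 1) = axis (s j) 1" for j
  proof -
    have "inv s i = j \<longleftrightarrow> i = s j" for i using s by (metis bij_inv_eq_iff)
    then show ?thesis by (simp add: reindex_def vec_eq_iff axis_def)
  qed
  have M: "matrix (\<lambda>v. reindex s (A (reindex (inv s) v))) $ i $ j = matrix A $ s i $ s j" for i j
    by (simp add: matrix_def ax) (simp add: reindex_def)
  have "det (matrix (\<lambda>v. reindex s (A (reindex (inv s) v)))) =
      (\<Sum>q\<in>{q. q permutes UNIV}. of_int (sign q) * (\<Prod>i\<in>UNIV. matrix A $ s i $ s (q i)))"
    unfolding det_def M ..
  also have "\<dots> = (\<Sum>p\<in>{p. p permutes UNIV}. of_int (sign p) * (\<Prod>i\<in>UNIV. matrix A $ i $ p i))"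
  proof (rule sum.reindex_bij_witness[where j = "\<lambda>q. s \<circ> q \<circ> inv s" and i = "\<lambda>p. inv s \<circ> p \<circ> s"])
    fix q :: "'m \<Rightarrow> 'm" assume q: "q \<in> {q. q permutes UNIV}"
    show "inv s \<circ> (s \<circ> q \<circ> inv s) \<circ> s = q" using s by (auto simp: fun_eq_iff bij_is_inj)
    show *: "s \<circ> q \<circ> inv s \<in> {p. p permutes UNIV}"
      using s q by (auto intro!: bij_imp_permutes bij_comp bij_imp_bij_inv permutes_bij)
    have "sign (s \<circ> q \<circ> inv s) = sign q"
      using sign_map_permutation[of s UNIV q] s q
      by (simp add: map_permutation_def restrict_id_def comp_def bij_is_inj bij_is_surj)
    moreover have "(\<Prod>i\<in>UNIV. matrix A $ i $ (s \<circ> q \<circ> inv s) i) = (\<Prod>i\<in>UNIV. matrix A $ s i $ s (q i))"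
      using prod.reindex_bij_betw[OF s, of "\<lambda>i. matrix A $ i $ (s \<circ> q \<circ> inv s) i"] s
      by (simp add: bij_is_inj)
    ultimately show "of_int (sign (s \<circ> q \<circ> inv s)) * (\<Prod>i\<in>UNIV. matrix A $ i $ (s \<circ> q \<circ> inv s) i) =
        of_int (sign q) * (\<Prod>i\<in>UNIV. matrix A $ s i $ s (q i))" by simp
  next
    fix p :: "'n \<Rightarrow> 'n" assume p: "p \<in> {p. p permutes UNIV}"
    show "s \<circ> (inv s \<circ> p \<circ> s) \<circ> inv s = p"
      using s by (auto simp: fun_eq_iff bij_is_surj surj_f_inv_f)
    show "inv s \<circ> p \<circ> s \<in> {q. q permutes UNIV}"
      using s p by (auto intro!: bij_imp_permutes bij_comp bij_imp_bij_inv permutes_bij)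
  qed
  finally show ?thesis by (simp add: det_def)
qed

lemma has_derivative_linear_conj:
  fixes f :: "'a::euclidean_space \<Rightarrow> 'a" and R :: "'a \<Rightarrow> 'b::euclidean_space" and R' :: "'b \<Rightarrow> 'a"
  assumes "linear R" "linear R'" "(f has_derivative f') (at (R' x))"
  shows "((\<lambda>x. R (f (R' x))) has_derivative (\<lambda>v. R (f' (R' v)))) (at x)"
proof -
  have "((\<lambda>x. f (R' x)) has_derivative (\<lambda>v. f' (R' v))) (at x)"
    using has_derivative_compose[OF linear_imp_has_derivative[OF assms(2)] assms(3)] .
  from has_derivative_compose[OF this linear_imp_has_derivative[OF assms(1)]] show ?thesis .
qed

text \<open>Renaming the coordinates is a linear homeomorphism. It carries closure, frontier and
  zeros along and leaves the Jacobian determinants unchanged, so the well-ordered case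
  transfers.\<close>

lemma sum_sgn_det_homotopy:
  fixes h0 h1 :: "real^'n \<Rightarrow> real^'n"
  assumes V: "open V" "bounded V"
    and cont: "continuous_on (closure V) h0" "continuous_on (closure V) h1"
    and h: "C1_on V h0 h0'" "C1_on V h1 h1'"
    and fr: "\<And>x t. x \<in> frontier V \<Longrightarrow> 0 \<le> t \<Longrightarrow> t \<le> 1 \<Longrightarrow> h0 x + t *\<^sub>R (h1 x - h0 x) \<noteq> 0"
    and reg: "\<And>x. x \<in> V \<Longrightarrow> h0 x = 0 \<Longrightarrow> det (matrix (h0' x)) \<noteq> 0"
      "\<And>x. x \<in> V \<Longrightarrow> h1 x = 0 \<Longrightarrow> det (matrix (h1' x)) \<noteq> 0"
  shows "(\<Sum>x | x \<in> V \<and> h0 x = 0. sgn (det (matrix (h0' x)))) =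
    (\<Sum>x | x \<in> V \<and> h1 x = 0. sgn (det (matrix (h1' x))))"
proof -
  define s :: "'n wo \<Rightarrow> 'n" where "s = of_wo"
  have s: "bij s" unfolding s_def by (rule bij_of_wo)
  let ?R = "reindex s" and ?R' = "reindex (inv s)"
  note RR = reindex_inv[OF s]
  have lin: "linear ?R" "linear ?R'" by (rule linear_reindex)+
  have injR: "inj ?R" by (rule inj_on_inverseI[of UNIV ?R']) (rule RR(2))
  have R0: "?R x = 0 \<longleftrightarrow> x = 0" for x using linear_injective_0[OF lin(1)] injR linear_0[OF lin(1)] by auto
  have im: "?R ` S = ?R' -` S" for S using RR by (auto simp: image_iff) metis
  have op: "open (?R ` V)"
    unfolding im using V(1) linear_continuous_on[OF lin(2)[unfolded linear_conv_bounded_linear]]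
    by (intro open_vimage) auto
  have bd: "bounded (?R ` V)" using V(2) lin(1) by (simp add: bounded_linear_image linear_conv_bounded_linear)
  have cl: "closure (?R ` V) = ?R ` closure V"
    using closure_injective_linear_image[OF lin(1) injR] by simp
  have frn: "frontier (?R ` V) = ?R ` frontier V"
    using op V(1) injR unfolding frontier_def cl by (simp add: interior_open image_set_diff)
  let ?c = "\<lambda>h x. ?R (h (?R' x))" and ?d = "\<lambda>h' x v. ?R (h' (?R' x) (?R' v))"
  have cont': "continuous_on (closure (?R ` V)) (?c h)" if "continuous_on (closure V) h" for h
  proof -
    have "continuous_on (?R ` closure V) ?R'" using lin(2) by (rule linear_continuous_on_compose[OF continuous_on_id])
    then have "continuous_on (?R ` closure V) (\<lambda>x. h (?R' x))"
      by (rule continuous_on_compose2[OF that]) (auto simp: RR)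
    then show ?thesis unfolding cl using lin(1) by (rule linear_continuous_on_compose)
  qed
  have C1': "C1_on (?R ` V) (?c h) (?d h')" if h: "C1_on V h h'" for h h'
    unfolding C1_on_def
  proof (intro conjI ballI allI)
    fix x assume "x \<in> ?R ` V"
    then have "?R' x \<in> V" by (auto simp: RR)
    from has_derivative_linear_conj[OF lin C1_on_D(1)[OF h this]]
    show "(?c h has_derivative ?d h' x) (at x)" .
  next
    fix v
    have "continuous_on (?R ` V) ?R'" using lin(2) by (rule linear_continuous_on_compose[OF continuous_on_id])
    then have "continuous_on (?R ` V) (\<lambda>x. h' (?R' x) (?R' v))"
      by (rule continuous_on_compose2[OF C1_on_D(2)[OF h]]) (auto simp: RR)
    then show "continuous_on (?R ` V) (\<lambda>x. ?d h' x v)" using lin(1) by (rule linear_continuous_on_compose)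
  qed
  have zeros: "{x. x \<in> ?R ` V \<and> ?c h x = 0} = ?R ` {x. x \<in> V \<and> h x = 0}" for h
    using RR R0 by auto
  have dets: "det (matrix (?d h' (?R x))) = det (matrix (h' x))" for h' x
    using det_matrix_reindex[OF s, of "h' x"] by (simp add: RR)
  have sums: "(\<Sum>x | x \<in> ?R ` V \<and> ?c h x = 0. sgn (det (matrix (?d h' x)))) =
      (\<Sum>x | x \<in> V \<and> h x = 0. sgn (det (matrix (h' x))))" for h h'
    unfolding zeros using injR by (subst sum.reindex) (auto simp: dets intro: inj_on_subset)
  have "(\<Sum>x | x \<in> ?R ` V \<and> ?c h0 x = 0. sgn (det (matrix (?d h0' x)))) =
      (\<Sum>x | x \<in> ?R ` V \<and> ?c h1 x = 0. sgn (det (matrix (?d h1' x))))"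
  proof (rule sum_sgn_det_homotopy_wellorder[OF op bd cont'[OF cont(1)] cont'[OF cont(2)] C1'[OF h(1)] C1'[OF h(2)]])
    fix x and t :: real assume "x \<in> frontier (?R ` V)" and t: "0 \<le> t" "t \<le> 1"
    then obtain z where z: "z \<in> frontier V" "x = ?R z" unfolding frn by blast
    have "?c h0 x + t *\<^sub>R (?c h1 x - ?c h0 x) = ?R (h0 z + t *\<^sub>R (h1 z - h0 z))"
      by (simp add: z(2) RR linear_add[OF lin(1)] linear_diff[OF lin(1)] linear_cmul[OF lin(1)])
    then show "?c h0 x + t *\<^sub>R (?c h1 x - ?c h0 x) \<noteq> 0" using fr[OF z(1) t] R0 by simp
  next
    fix x assume "x \<in> ?R ` V" "?c h0 x = 0"
    then show "det (matrix (?d h0' x)) \<noteq> 0" using reg(1) R0 dets RR by auto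
  next
    fix x assume "x \<in> ?R ` V" "?c h1 x = 0"
    then show "det (matrix (?d h1' x)) \<noteq> 0" using reg(2) R0 dets RR by auto
  qed
  then show ?thesis unfolding sums .
qed

section \<open>Regular values near a given point\<close>

text \<open>By Sard the critical values form a negligible set, which cannot contain a ball.\<close>

lemma regular_value_near_wellorder:
  fixes p :: "real^'n::{finite,wellorder} \<Rightarrow> real^'n::_"
  assumes p: "\<And>x. (p has_derivative p' x) (at x)" and e: "0 < e"
  obtains z where "norm (z - y) < e" "\<And>x. p x = z \<Longrightarrow> det (matrix (p' x)) \<noteq> 0"
proof -
  let ?S = "{x. det (matrix (p' x)) = 0}"
  have "negligible (p ` ?S)"
  proof (rule baby_Sard)
    show "(p has_derivative p' x) (at x within ?S)" for x using p has_derivative_at_withinI by blast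
    show "rank (matrix (p' x)) < CARD('n)" if "x \<in> ?S" for x using that det_eq_0_rank by auto
  qed auto
  moreover have "\<not> negligible (ball y e)" using e by (intro open_not_negligible) auto
  ultimately have "\<not> ball y e \<subseteq> p ` ?S" using negligible_subset by blast
  then obtain z where "z \<in> ball y e" "z \<notin> p ` ?S" by blast
  then show thesis using that[of z] by (auto simp: dist_norm norm_minus_commute)
qed

lemma regular_value_near:
  fixes p :: "real^'n \<Rightarrow> real^'n"
  assumes p: "\<And>x. (p has_derivative p' x) (at x)" and e: "0 < e"
  obtains z where "norm (z - y) < e" "\<And>x. p x = z \<Longrightarrow> det (matrix (p' x)) \<noteq> 0"
proof -
  define s :: "'n wo \<Rightarrow> 'n" where "s = of_wo"
  have s: "bij s" unfolding s_def by (rule bij_of_wo)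
  let ?R = "reindex s" and ?R' = "reindex (inv s)"
  note RR = reindex_inv[OF s]
  have lin: "linear ?R" "linear ?R'" by (rule linear_reindex)+
  \<comment> \<open>\<open>K\<close> bounds the expansion of norms by \<open>?R'\<close>, whence the
    radius \<open>e / K\<close> in the renamed coordinates.\<close>
  obtain K where K: "0 < K" "\<And>v. norm (?R' v) \<le> norm v * K"
    using bounded_linear.pos_bounded[OF lin(2)[unfolded linear_conv_bounded_linear]] by blast
  have "((\<lambda>x. ?R (p (?R' x))) has_derivative (\<lambda>v. ?R (p' (?R' x) (?R' v)))) (at x)" for x
    by (rule has_derivative_linear_conj[OF lin p])
  then obtain w where w: "norm (w - ?R y) < e / K"
    "\<And>x. ?R (p (?R' x)) = w \<Longrightarrow> det (matrix (\<lambda>v. ?R (p' (?R' x) (?R' v)))) \<noteq> 0"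
    by (rule regular_value_near_wellorder[where e = "e / K" and y = "?R y"]) (use e K in auto)
  show thesis
  proof
    have "norm (?R' (w - ?R y)) \<le> norm (w - ?R y) * K" by (rule K(2))
    also have "\<dots> < e" using w(1) K(1) by (simp add: pos_less_divide_eq)
    finally show "norm (?R' w - y) < e" by (simp add: linear_diff[OF lin(2)] RR)
    show "det (matrix (p' x)) \<noteq> 0" if "p x = ?R' w" for x
      using w(2)[of "?R x"] that det_matrix_reindex[OF s, of "p' x"] by (simp add: RR)
  qed
qed

section \<open>The degree\<close>

text \<open>\<open>f\<close> is known to agree with its smooth extension \<open>g\<close> only on
  \<open>X\<close>. On an open subset of \<open>X\<close> this suffices for the derivative of
  \<open>f\<close> itself to exist and to equal that of \<open>g\<close>.\<close>

lemma smooth_on_imp_C1_on: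
  assumes "smooth_on X f" "open U" "U \<subseteq> X"
  shows "C1_on U f (\<lambda>x. frechet_derivative f (at x))"
proof -
  obtain W g where W: "open W" "X \<subseteq> W" "\<And>n. Ck_on_open n W g" "\<And>x. x \<in> X \<Longrightarrow> g x = f x"
    using assms(1) unfolding smooth_on_def by blast
  have "C1_on W g (\<lambda>x. frechet_derivative g (at x))"
    using W(3)[of "Suc 0"] by (simp add: C1_on_def frechet_derivative_works)
  then have g: "C1_on U g (\<lambda>x. frechet_derivative g (at x))"
    by (rule C1_on_subset) (use W(2) assms(3) in blast)
  have eq: "g x = f x" if "x \<in> U" for x using W(4) assms(3) that by blast
  have "(f has_derivative frechet_derivative g (at x)) (at x)" if "x \<in> U" for x
    using has_derivative_transform_within_open[OF C1_on_D(1)[OF g that] assms(2) that] eq by simp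
  then have "frechet_derivative g (at x) = frechet_derivative f (at x)" if "x \<in> U" for x
    using that frechet_derivative_at by blast
  then show ?thesis using C1_on_transform[OF g assms(2)] eq by simp
qed

lemma deg_regular_eq_sum:
  "real_of_int (deg_regular f U y) = (\<Sum>x | x \<in> U \<and> f x = y. sgn (jacobian_det f x))"
proof -
  have "real_of_int \<lfloor>sgn t\<rfloor> = sgn t" for t :: real by (simp add: sgn_if)
  then show ?thesis by (simp only: deg_regular_def of_int_sum)
qed

text \<open>Both \<open>g0 - z0\<close> and \<open>g1 - z1\<close> differ from \<open>f - y\<close>
  on the frontier by less than \<open>norm (f x - y)\<close>, and so do all their convex
  combinations. Hence the segment between them avoids 0 on the frontier, and the sums of signs
  agree.\<close>

lemma regular_approx_unique:
  assumes bd: "bounded U" and a0: "regular_approx f U y g0 z0" and a1: "regular_approx f U y g1 z1"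
  shows "deg_regular g0 U z0 = deg_regular g1 U z1"
proof -
  have U: "open U" using a0 by (simp add: regular_approx_def regular_def admissible_def)
  have *: "continuous_on (closure U) (\<lambda>x. g x - z) \<and>
      C1_on U (\<lambda>x. g x - z) (\<lambda>x. frechet_derivative g (at x)) \<and>
      (\<forall>x\<in>U. g x - z = 0 \<longrightarrow> det (matrix (frechet_derivative g (at x))) \<noteq> 0) \<and>
      (\<exists>e. (\<forall>x\<in>closure U. norm ((g x - z) - (f x - y)) \<le> e) \<and> (\<forall>x\<in>frontier U. e < norm (f x - y)))"
    if a: "regular_approx f U y g z" for g z
  proof (intro conjI)
    have reg: "admissible g U z" "smooth_on (closure U) g" "\<forall>x\<in>U. g x = z \<longrightarrow> jacobian_det g x \<noteq> 0"
      using a by (auto simp: regular_approx_def regular_def)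
    show "continuous_on (closure U) (\<lambda>x. g x - z)"
      using reg(1) by (intro continuous_intros) (simp add: admissible_def)
    have "C1_on U g (\<lambda>x. frechet_derivative g (at x))"
      using smooth_on_imp_C1_on[OF reg(2) U closure_subset] .
    from C1_on_diff[OF this C1_on_const[of U z]]
    show "C1_on U (\<lambda>x. g x - z) (\<lambda>x. frechet_derivative g (at x))" by simp
    show "\<forall>x\<in>U. g x - z = 0 \<longrightarrow> det (matrix (frechet_derivative g (at x))) \<noteq> 0"
      using reg(3) by (simp add: jacobian_det_def)
    obtain \<epsilon> \<sigma> where e: "\<forall>x\<in>closure U. norm (g x - f x) \<le> \<epsilon>" "norm (z - y) \<le> \<sigma>"
      "frontier U \<noteq> {} \<longrightarrow> \<epsilon> + \<sigma> < infdist y (f ` frontier U)"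
      using a unfolding regular_approx_def by blast
    have "norm ((g x - z) - (f x - y)) \<le> \<epsilon> + \<sigma>" if "x \<in> closure U" for x
      using norm_triangle_ineq4[of "g x - f x" "z - y"] e(1,2) that by (fastforce simp: algebra_simps)
    moreover have "\<epsilon> + \<sigma> < norm (f x - y)" if "x \<in> frontier U" for x
      using infdist_le[of "f x" "f ` frontier U" y] e(3) that by (force simp: dist_norm norm_minus_commute)
    ultimately show "\<exists>e. (\<forall>x\<in>closure U. norm ((g x - z) - (f x - y)) \<le> e) \<and>
        (\<forall>x\<in>frontier U. e < norm (f x - y))" by blast
  qed
  obtain e0 where e0: "\<And>x. x \<in> closure U \<Longrightarrow> norm ((g0 x - z0) - (f x - y)) \<le> e0"
    "\<And>x. x \<in> frontier U \<Longrightarrow> e0 < norm (f x - y)" using *[OF a0] by blast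
  obtain e1 where e1: "\<And>x. x \<in> closure U \<Longrightarrow> norm ((g1 x - z1) - (f x - y)) \<le> e1"
    "\<And>x. x \<in> frontier U \<Longrightarrow> e1 < norm (f x - y)" using *[OF a1] by blast
  have "(\<Sum>x | x \<in> U \<and> g0 x - z0 = 0. sgn (det (matrix (frechet_derivative g0 (at x))))) =
    (\<Sum>x | x \<in> U \<and> g1 x - z1 = 0. sgn (det (matrix (frechet_derivative g1 (at x)))))"
  proof (rule sum_sgn_det_homotopy[OF U bd])
    fix x and t :: real assume x: "x \<in> frontier U" and t: "0 \<le> t" "t \<le> 1"
    define p where "p = (g0 x - z0) - (f x - y)"
    define q where "q = (g1 x - z1) - (f x - y)"
    have xc: "x \<in> closure U" using x by (simp add: frontier_def)
    show "(g0 x - z0) + t *\<^sub>R ((g1 x - z1) - (g0 x - z0)) \<noteq> 0"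
    proof
      assume "(g0 x - z0) + t *\<^sub>R ((g1 x - z1) - (g0 x - z0)) = 0"
      then have "f x - y = - ((1 - t) *\<^sub>R p + t *\<^sub>R q)" by (simp add: p_def q_def algebra_simps)
      then have "norm (f x - y) = norm ((1 - t) *\<^sub>R p + t *\<^sub>R q)" by (simp only: norm_minus_cancel)
      also have "\<dots> \<le> (1 - t) * norm p + t * norm q"
        using norm_triangle_ineq[of "(1 - t) *\<^sub>R p" "t *\<^sub>R q"] t by simp
      also have "\<dots> \<le> (1 - t) * max e0 e1 + t * max e0 e1"
        using e0(1)[OF xc] e1(1)[OF xc] t unfolding p_def q_def
        by (intro add_mono mult_left_mono) auto
      also have "\<dots> = max e0 e1" by (simp add: algebra_simps)
      finally show False using e0(2)[OF x] e1(2)[OF x] by simp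
    qed
  qed (use *[OF a0] *[OF a1] in auto)
  then have "real_of_int (deg_regular g0 U z0) = real_of_int (deg_regular g1 U z1)"
    by (simp add: deg_regular_eq_sum jacobian_det_def)
  then show ?thesis by simp
qed

lemma deg_admissible_eq:
  assumes "bounded U" "regular_approx f U y g z"
  shows "deg_admissible f U y = deg_regular g U z"
  unfolding deg_admissible_def
proof (rule the_equality)
  show "\<exists>g' z'. regular_approx f U y g' z' \<and> deg_regular g U z = deg_regular g' U z'"
    using assms(2) by blast
  show "d = deg_regular g U z" if "\<exists>g z. regular_approx f U y g z \<and> d = deg_regular g U z" for d
    using that regular_approx_unique[OF assms(1) _ assms(2)] by blast
qed

section \<open>Regular approximation by polynomials\<close>

text \<open>Polynomials are closed under differentiation in a fixed direction, by the sum and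
  product rules. This matches the recursion of \<open>Ck_on_open\<close> and so yields smoothness of
  every order.\<close>

lemma real_polynomial_function_derivative:
  fixes p :: "'a::euclidean_space \<Rightarrow> real"
  assumes "real_polynomial_function p"
  shows "\<exists>p'. (\<forall>x. (p has_derivative p' x) (at x)) \<and> (\<forall>v. real_polynomial_function (\<lambda>x. p' x v))"
  using assms
proof induction
  case (linear f)
  then show ?case
    by (intro exI[of _ "\<lambda>x. f"]) (auto intro: bounded_linear_imp_has_derivative real_polynomial_function.intros)
next
  case (const c)
  then show ?case
    by (intro exI[of _ "\<lambda>x v. 0"]) (auto intro: real_polynomial_function.intros)
next
  case (add f g)
  then obtain f' g' where "\<And>x. (f has_derivative f' x) (at x)" "\<And>v. real_polynomial_function (\<lambda>x. f' x v)"
    "\<And>x. (g has_derivative g' x) (at x)" "\<And>v. real_polynomial_function (\<lambda>x. g' x v)" by blast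
  then show ?case
    by (intro exI[of _ "\<lambda>x v. f' x v + g' x v"])
      (auto intro!: derivative_eq_intros real_polynomial_function.intros(3))
next
  case (mult f g)
  then obtain f' g' where "\<And>x. (f has_derivative f' x) (at x)" "\<And>v. real_polynomial_function (\<lambda>x. f' x v)"
    "\<And>x. (g has_derivative g' x) (at x)" "\<And>v. real_polynomial_function (\<lambda>x. g' x v)" by blast
  then show ?case using mult.hyps
    by (intro exI[of _ "\<lambda>x v. f x * g' x v + f' x v * g x"])
      (auto intro!: derivative_eq_intros real_polynomial_function.intros(3,4))
qed

lemma polynomial_function_derivative:
  fixes p :: "'a::euclidean_space \<Rightarrow> 'b::euclidean_space"
  assumes p: "polynomial_function p"
  shows "(p has_derivative frechet_derivative p (at x)) (at x)"
    and "polynomial_function (\<lambda>x. frechet_derivative p (at x) v)"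
proof -
  show d: "(p has_derivative frechet_derivative p (at x)) (at x)" for x
    using differentiable_at_polynomial_function[OF p] frechet_derivative_works by blast
  show "polynomial_function (\<lambda>x. frechet_derivative p (at x) v)"
    unfolding polynomial_function_iff_Basis_inner
  proof
    fix b :: 'b assume b: "b \<in> Basis"
    then have "real_polynomial_function (\<lambda>x. p x \<bullet> b)"
      using p polynomial_function_iff_Basis_inner by blast
    then obtain q where q: "\<And>x. ((\<lambda>x. p x \<bullet> b) has_derivative q x) (at x)"
      "\<And>v. real_polynomial_function (\<lambda>x. q x v)"
      using real_polynomial_function_derivative by blast
    have "((\<lambda>x. p x \<bullet> b) has_derivative (\<lambda>v. frechet_derivative p (at x) v \<bullet> b)) (at x)" for x
      using has_derivative_inner_left[OF d] .
    then have "(\<lambda>v. frechet_derivative p (at x) v \<bullet> b) = q x" for x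
      using q(1) by (rule has_derivative_unique)
    then have "(\<lambda>x. frechet_derivative p (at x) v \<bullet> b) = (\<lambda>x. q x v)" by (metis (no_types))
    then show "real_polynomial_function (\<lambda>x. frechet_derivative p (at x) v \<bullet> b)" using q(2) by simp
  qed
qed

lemma smooth_on_polynomial_function:
  fixes p :: "'a::euclidean_space \<Rightarrow> 'b::euclidean_space"
  assumes "polynomial_function p"
  shows "smooth_on X p"
proof -
  have "Ck_on_open n UNIV p" for n
    using assms
  proof (induction n arbitrary: p)
    case 0
    then show ?case by (simp add: continuous_on_polymonial_function)
  next
    case (Suc n)
    then show ?case
      using polynomial_function_derivative(2) differentiable_at_polynomial_function by auto
  qed
  then show ?thesis unfolding smooth_on_def by (intro exI[of _ UNIV] exI[of _ p]) auto
qed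

text \<open>The bound is strict and exists for empty \<open>S\<close> too, so an empty frontier
  needs no separate case below.\<close>

lemma compact_norm_lower_bound:
  fixes F :: "'a::topological_space \<Rightarrow> 'b::{real_normed_vector,heine_borel}"
  assumes "compact S" "continuous_on S F" "\<And>x. x \<in> S \<Longrightarrow> F x \<noteq> 0"
  shows "\<exists>m>0. \<forall>x\<in>S. m < norm (F x)"
proof -
  have "closed (F ` S)" "0 \<notin> F ` S"
    using assms by (auto simp: compact_continuous_image compact_imp_closed)
  then obtain d where "0 < d" "\<And>y. y \<in> F ` S \<Longrightarrow> d \<le> dist 0 y"
    using separate_point_closed by metis
  then have "d / 2 < norm (F x)" if "x \<in> S" for x using that by fastforce
  then show ?thesis using \<open>0 < d\<close> by (intro exI[of _ "d / 2"]) auto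
qed

text \<open>Properness is automatic: preimages of compact sets are closed in the compact
  closure.\<close>

lemma admissible_bounded:
  assumes U: "open U" "bounded U" and f: "continuous_on (closure U) f" and "\<And>x. x \<in> frontier U \<Longrightarrow> f x \<noteq> y"
  shows "admissible f U y"
proof -
  have "compact {x \<in> closure U. f x \<in> K}" if "compact K" for K
  proof -
    have "closed (closure U \<inter> f -` K)"
      using that by (intro continuous_closed_preimage[OF f]) (auto simp: compact_imp_closed)
    moreover have "bounded (closure U \<inter> f -` K)"
      using bounded_closure[OF U(2)] by (rule bounded_subset) blast
    ultimately have "compact (closure U \<inter> f -` K)" by (simp add: compact_eq_bounded_closed)
    then show ?thesis by (simp add: vimage_def Int_def)
  qed
  then show ?thesis using assms by (simp add: admissible_def proper_on_def)
qed

text \<open>Both tolerances are taken to be \<open>e\<close>. As the frontier is compact, a nonempty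
  one attains the distance to \<open>y\<close>, so the strict pointwise bound passes to the
  distance.\<close>

lemma regular_approxI:
  fixes f g :: "real^'n \<Rightarrow> real^'n"
  assumes U: "open U" "bounded U" and f: "continuous_on (closure U) f"
    and g: "polynomial_function g" "\<And>x. g x = z \<Longrightarrow> jacobian_det g x \<noteq> 0"
    and e: "0 < e" "\<And>x. x \<in> closure U \<Longrightarrow> norm (g x - f x) \<le> e" "norm (z - y) \<le> e"
      "\<And>x. x \<in> frontier U \<Longrightarrow> 2 * e < norm (f x - y)"
  shows "regular_approx f U y g z"
proof -
  have "g x \<noteq> z" if x: "x \<in> frontier U" for x
  proof
    assume "g x = z"
    then have "norm (f x - y) \<le> norm (z - y) + norm (g x - f x)"
      using norm_triangle_ineq4[of "z - y" "g x - f x"] by simp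
    also have "\<dots> \<le> 2 * e" using e(2)[of x] e(3) x by (simp add: frontier_def)
    finally show False using e(4)[OF x] by simp
  qed
  then have "admissible g U z"
    using U by (intro admissible_bounded continuous_on_polymonial_function g) auto
  moreover have "e + e < infdist y (f ` frontier U)" if "frontier U \<noteq> {}"
  proof -
    have "compact (f ` frontier U)"
      using U f by (intro compact_continuous_image compact_frontier_bounded)
        (auto intro: continuous_on_subset simp: frontier_def)
    then have "closed (f ` frontier U)" "f ` frontier U \<noteq> {}" using that compact_imp_closed by auto
    then obtain w where "w \<in> f ` frontier U" "infdist y (f ` frontier U) = dist y w"
      by (rule infdist_attains_inf)
    then show ?thesis using e(4) by (auto simp: dist_norm norm_minus_commute)
  qed
  ultimately show ?thesis
    unfolding regular_approx_def regular_def
    using g smooth_on_polynomial_function e by blast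
qed

text \<open>Stone--Weierstrass gives \<open>g\<close>, and Sard then moves \<open>y\<close> to a
  nearby regular value \<open>z\<close> of \<open>g\<close>. Regularity holds on the whole space, so
  one pair \<open>(g, z)\<close> can serve several open sets.\<close>

lemma polynomial_approx_regular_value:
  fixes f :: "real^'n \<Rightarrow> real^'n"
  assumes "compact S" "continuous_on S f" "0 < e"
  obtains g z where "polynomial_function g" "\<And>x. x \<in> S \<Longrightarrow> norm (g x - f x) \<le> e" "norm (z - y) \<le> e"
    "\<And>x. g x = z \<Longrightarrow> jacobian_det g x \<noteq> 0"
proof -
  obtain g where g: "polynomial_function g" "\<And>x. x \<in> S \<Longrightarrow> norm (f x - g x) < e"
    using Stone_Weierstrass_polynomial_function[OF assms] by blast
  obtain z where "norm (z - y) < e" "\<And>x. g x = z \<Longrightarrow> det (matrix (frechet_derivative g (at x))) \<noteq> 0"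
    using regular_value_near[OF polynomial_function_derivative(1)[OF g(1)] assms(3)] by blast
  then show thesis
    using that[of g z] g by (auto simp: jacobian_det_def norm_minus_commute less_imp_le)
qed

text \<open>One pair \<open>(g, z)\<close> approximates on both sets. Its two errors of
  \<open>m / 2\<close> cannot bridge the gap \<open>m < norm (f x - y)\<close> outside
  \<open>V\<close>, so all solutions of \<open>g x = z\<close> in \<open>W\<close> lie in
  \<open>V\<close>.\<close>

lemma deg_admissible_excision:
  fixes f :: "real^'n \<Rightarrow> real^'n"
  assumes V: "open V" and W: "open W" "bounded W" and VW: "V \<subseteq> W" and f: "continuous_on (closure W) f"
    and nz: "\<And>x. x \<in> closure W - V \<Longrightarrow> f x \<noteq> y"
  shows "deg_admissible f V y = deg_admissible f W y"
proof -
  have bd: "bounded V" using W(2) VW bounded_subset by blast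
  have cl: "closure V \<subseteq> closure W" using VW by (rule closure_mono)
  have "compact (closure W - V)" using W V by (intro compact_diff) auto
  moreover have "continuous_on (closure W - V) (\<lambda>x. f x - y)"
    by (intro continuous_intros continuous_on_subset[OF f]) auto
  ultimately obtain m where m: "0 < m" "\<And>x. x \<in> closure W - V \<Longrightarrow> m < norm (f x - y)"
    using compact_norm_lower_bound[of "closure W - V" "\<lambda>x. f x - y"] nz by fastforce
  have "compact (closure W)" using W by simp
  then obtain g z where g: "polynomial_function g" "\<And>x. x \<in> closure W \<Longrightarrow> norm (g x - f x) \<le> m / 2"
    "norm (z - y) \<le> m / 2" "\<And>x. g x = z \<Longrightarrow> jacobian_det g x \<noteq> 0"
    using polynomial_approx_regular_value[OF _ f, of "m / 2" y] m(1) by auto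
  have "regular_approx f W y g z"
    by (rule regular_approxI[where e = "m / 2", OF W f g(1,4)])
      (use m g VW W in \<open>auto simp: frontier_def interior_open\<close>)
  moreover have "regular_approx f V y g z"
    by (rule regular_approxI[where e = "m / 2", OF V bd continuous_on_subset[OF f cl] g(1,4)])
      (use m g cl V in \<open>auto simp: frontier_def interior_open\<close>)
  moreover have "x \<in> V" if "x \<in> W" "g x = z" for x
  proof (rule ccontr)
    assume "x \<notin> V"
    then have x: "x \<in> closure W - V" using that closure_subset by blast
    have "norm (f x - y) \<le> norm (z - y) + norm (g x - f x)"
      using norm_triangle_ineq4[of "z - y" "g x - f x"] that by simp
    also have "\<dots> \<le> m" using g(2)[of x] g(3) x by auto
    finally show False using m(2)[OF x] by simp
  qed
  then have "{x. x \<in> V \<and> g x = z} = {x. x \<in> W \<and> g x = z}" using VW by blast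
  ultimately show ?thesis
    using deg_admissible_eq[OF bd] deg_admissible_eq[OF W(2)] by (simp add: deg_regular_def)
qed

section \<open>The degree of weakly admissible triples\<close>

text \<open>The set \<open>N\<close> on which a cutoff is 1 lies in the compact set \<open>L\<close>
  off which it is 0.\<close>

lemma compact_bounded_open_neighbourhood:
  fixes S U :: "'a::euclidean_space set"
  assumes "compact S" "open U" "S \<subseteq> U"
  obtains V where "open V" "bounded V" "S \<subseteq> V" "closure V \<subseteq> U"
proof -
  obtain c :: "'a \<Rightarrow> real" and c' N L where N: "open N" "S \<subseteq> N" "\<And>x. x \<in> N \<Longrightarrow> c x = 1"
    and L: "compact L" "L \<subseteq> U" "\<And>x. x \<notin> L \<Longrightarrow> c x = 0"
    by (rule C1_cutoff[OF assms]) blast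
  have "N \<subseteq> L" using N(3) L(3) by force
  then have "bounded N" "closure N \<subseteq> L"
    using bounded_subset[OF compact_imp_bounded[OF L(1)]] closure_minimal compact_imp_closed[OF L(1)] by blast+
  then show thesis using that N L(2) by blast
qed

text \<open>Two admissible choices \<open>V\<close> and \<open>W\<close> are both compared with
  \<open>V \<inter> W\<close> by excision, which makes the definite description meaningful.\<close>

lemma deg_eq_deg_admissible:
  fixes f :: "real^'n \<Rightarrow> real^'n"
  assumes w: "weakly_admissible f U y"
    and V: "open V" "bounded V" "{x \<in> U. f x = y} \<subseteq> V" "closure V \<subseteq> U"
  shows "deg f U y = deg_admissible f V y"
proof -
  have f: "continuous_on U f" using w by (simp add: weakly_admissible_def)
  have "deg_admissible f W y = deg_admissible f V y"
    if W: "open W" "bounded W" "{x \<in> U. f x = y} \<subseteq> W" "closure W \<subseteq> U" for W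
  proof -
    have "deg_admissible f (V \<inter> W) y = deg_admissible f V y"
      by (rule deg_admissible_excision) (use V W continuous_on_subset[OF f] in auto)
    moreover have "deg_admissible f (V \<inter> W) y = deg_admissible f W y"
      by (rule deg_admissible_excision) (use V W continuous_on_subset[OF f] in auto)
    ultimately show ?thesis by simp
  qed
  then show ?thesis
    unfolding deg_def using V by (intro the_equality) blast+
qed

section \<open>Normalization, additivity and homotopy invariance\<close>

lemma deg_normalization: "deg (id :: real^'n \<Rightarrow> real^'n) UNIV 0 = 1"
proof -
  let ?B = "ball 0 1 :: (real^'n) set"
  have "{x \<in> UNIV. id x = (0 :: real^'n)} = {0}" by auto
  then have "weakly_admissible (id :: real^'n \<Rightarrow> real^'n) UNIV 0"
    by (simp add: weakly_admissible_def continuous_on_id)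
  then have "deg (id :: real^'n \<Rightarrow> real^'n) UNIV 0 = deg_admissible id ?B 0"
    by (rule deg_eq_deg_admissible) auto
  also have jac: "jacobian_det id x = 1" for x :: "real^'n"
    using frechet_derivative_id[of x] by (simp add: jacobian_det_def id_def matrix_id_mat_1[unfolded id_def])
  have "regular_approx id ?B 0 id 0"
    \<comment> \<open>The frontier of the unit ball has norm 1, so any \<open>e\<close> with
      \<open>0 < 2 * e < 1\<close> would do.\<close>
    by (rule regular_approxI[where e = "1/4"]) (use jac in \<open>auto simp: id_def\<close>)
  then have "deg_admissible id ?B 0 = deg_regular id ?B 0" by (intro deg_admissible_eq) auto
  also have "{x. x \<in> ?B \<and> id x = 0} = {0}" by auto
  then have "deg_regular id ?B 0 = 1" by (simp add: deg_regular_def jac)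
  finally show ?thesis .
qed

lemma deg_additivity:
  fixes f :: "real^'n \<Rightarrow> real^'n"
  assumes w: "weakly_admissible f U y" and op: "open U1" "open U2" and sub: "U1 \<subseteq> U" "U2 \<subseteq> U"
    and disj: "U1 \<inter> U2 = {}" and cov: "{x \<in> U. f x = y} \<subseteq> U1 \<union> U2"
  shows "deg f U y = deg f U1 y + deg f U2 y"
proof -
  let ?S = "{x \<in> U. f x = y}"
  have f: "continuous_on U f" and S: "compact ?S" using w by (auto simp: weakly_admissible_def)
  \<comment> \<open>Removing the other open set from the compact zero set shows that each part is
    compact.\<close>
  have "{x \<in> U1. f x = y} = ?S - U2" "{x \<in> U2. f x = y} = ?S - U1" using sub disj cov by auto
  then have c: "compact {x \<in> U1. f x = y}" "compact {x \<in> U2. f x = y}"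
    using S op by (simp_all add: compact_diff)
  have w12: "weakly_admissible f U1 y" "weakly_admissible f U2 y"
    using c op continuous_on_subset[OF f] sub by (auto simp: weakly_admissible_def)
  obtain V1 where V1: "open V1" "bounded V1" "{x \<in> U1. f x = y} \<subseteq> V1" "closure V1 \<subseteq> U1"
    using compact_bounded_open_neighbourhood[OF c(1) op(1)] by blast
  obtain V2 where V2: "open V2" "bounded V2" "{x \<in> U2. f x = y} \<subseteq> V2" "closure V2 \<subseteq> U2"
    using compact_bounded_open_neighbourhood[OF c(2) op(2)] by blast
  let ?V = "V1 \<union> V2"
  have V: "open ?V" "bounded ?V" "?S \<subseteq> ?V" "closure ?V \<subseteq> U" using V1 V2 sub cov by (auto simp: closure_Un)
  have sub12: "V1 \<subseteq> U1" "V2 \<subseteq> U2" using V1(4) V2(4) closure_subset by blast+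
  have fV: "continuous_on (closure ?V) f" using f V(4) by (rule continuous_on_subset)
  \<comment> \<open>The closure of \<open>V1\<close> lies in \<open>U1\<close>, which is disjoint
    from \<open>V2\<close>; so a frontier point of \<open>V1\<close> is outside \<open>V2\<close>
    and stays a frontier point of the union. The same holds for \<open>V2\<close>.\<close>
  have fr: "frontier V1 \<subseteq> frontier ?V" "frontier V2 \<subseteq> frontier ?V"
    using V1(1,4) V2(1,4) disj sub12 V(1)
    by (auto simp: frontier_def interior_open closure_Un)
  have "compact (frontier ?V)" using V(2) by (rule compact_frontier_bounded)
  moreover have "continuous_on (frontier ?V) (\<lambda>x. f x - y)"
    by (intro continuous_intros continuous_on_subset[OF fV]) (auto simp: frontier_def)
  moreover have "f x - y \<noteq> 0" if "x \<in> frontier ?V" for x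
    using that V(1,3,4) by (auto simp: frontier_def interior_open)
  ultimately obtain m where m: "0 < m" "\<And>x. x \<in> frontier ?V \<Longrightarrow> m < norm (f x - y)"
    using compact_norm_lower_bound[of "frontier ?V" "\<lambda>x. f x - y"] by blast
  have "compact (closure ?V)" using compact_closure V(2) by blast
  then obtain g z where g: "polynomial_function g" "\<And>x. x \<in> closure ?V \<Longrightarrow> norm (g x - f x) \<le> m / 2"
    "norm (z - y) \<le> m / 2" "\<And>x. g x = z \<Longrightarrow> jacobian_det g x \<noteq> 0"
    using polynomial_approx_regular_value[OF _ fV, of "m / 2" y] m(1) by auto
  have approx: "regular_approx f T y g z"
    if "open T" "bounded T" "closure T \<subseteq> closure ?V" "frontier T \<subseteq> frontier ?V" for T
    by (rule regular_approxI[where e = "m / 2", OF that(1,2) continuous_on_subset[OF fV that(3)] g(1,4)])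
      (use m g that in auto)
  \<comment> \<open>Finiteness matters because a sum over an infinite set is 0 by convention and
    would not split.\<close>
  have fin: "finite {x. x \<in> T \<and> g x = z}" if "regular_approx f T y g z" "bounded T" for T
  proof -
    have reg: "open T" "continuous_on (closure T) g" "smooth_on (closure T) g" "\<forall>x\<in>frontier T. g x \<noteq> z"
      using that by (auto simp: regular_approx_def regular_def admissible_def)
    have "C1_on T (\<lambda>x. g x - z) (\<lambda>x. frechet_derivative g (at x))"
      using C1_on_diff[OF smooth_on_imp_C1_on[OF reg(3,1) closure_subset] C1_on_const[of T z]] by simp
    then have "finite {x \<in> T. g x - z = 0}"
      using that(2) reg g(4) by (intro finite_regular_zeros[of T "\<lambda>x. g x - z"])
        (auto intro!: continuous_intros simp: jacobian_det_def)
    then show ?thesis by simp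
  qed
  have a: "regular_approx f ?V y g z" "regular_approx f V1 y g z" "regular_approx f V2 y g z"
    using V V1 V2 fr by (auto intro!: approx simp: closure_Un)
  have split: "{x. x \<in> ?V \<and> g x = z} = {x. x \<in> V1 \<and> g x = z} \<union> {x. x \<in> V2 \<and> g x = z}" by auto
  have "deg_regular g ?V z = deg_regular g V1 z + deg_regular g V2 z"
    unfolding deg_regular_def split using fin a V1(2) V2(2) sub12 disj
    by (intro sum.union_disjoint) auto
  then show ?thesis
    using deg_eq_deg_admissible[OF w V] deg_eq_deg_admissible[OF w12(1) V1] deg_eq_deg_admissible[OF w12(2) V2]
      deg_admissible_eq[OF V(2) a(1)] deg_admissible_eq[OF V1(2) a(2)] deg_admissible_eq[OF V2(2) a(3)]
    by simp
qed

lemma deg_homotopy_invariance: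
  fixes H :: "(real^'n) \<times> real \<Rightarrow> real^'n"
  assumes "weakly_admissible_homotopy H U \<alpha>"
  shows "deg (\<lambda>x. H (x, 0)) U (\<alpha> 0) = deg (\<lambda>x. H (x, 1)) U (\<alpha> 1)"
proof -
  let ?T = "{(x, t) \<in> U \<times> {0..1}. H (x, t) = \<alpha> t}"
  have U: "open U" and H: "continuous_on (U \<times> {0..1}) H" and al: "continuous_on {0..1} \<alpha>" and T: "compact ?T"
    using assms by (auto simp: weakly_admissible_homotopy_def path_def)
  \<comment> \<open>Projecting the solution set to the space gives one neighbourhood
    \<open>V\<close> that serves all times.\<close>
  have "compact (fst ` ?T)" using T by (intro compact_continuous_image continuous_intros)
  then obtain V where V: "open V" "bounded V" "fst ` ?T \<subseteq> V" "closure V \<subseteq> U"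
    by (rule compact_bounded_open_neighbourhood[OF _ U]) auto
  have zero: "x \<in> V" if "x \<in> U" "t \<in> {0..1}" "H (x, t) = \<alpha> t" for x t
    using V(3) that by force
  have w: "weakly_admissible (\<lambda>x. H (x, t)) U (\<alpha> t)" if t: "t \<in> {0..1}" for t
  proof -
    have "{x \<in> U. H (x, t) = \<alpha> t} = fst ` (?T \<inter> snd -` {t})" using t by force
    moreover have "compact (?T \<inter> snd -` {t})"
      using T by (intro compact_Int_closed continuous_closed_vimage) (auto intro: continuous_intros)
    then have "compact (fst ` (?T \<inter> snd -` {t}))" by (intro compact_continuous_image continuous_intros)
    moreover have "continuous_on U (\<lambda>x. H (x, t))"
      using t by (intro continuous_on_compose2[OF H] continuous_intros) auto
    ultimately show ?thesis using U by (simp add: weakly_admissible_def)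
  qed
  have Hc: "continuous_on (closure V \<times> {0..1}) H" using H V(4) by (rule continuous_on_subset[OF _ Sigma_mono]) auto
  have Ht: "continuous_on (closure V) (\<lambda>x. H (x, t))" if "t \<in> {0..1}" for t
    using that by (intro continuous_on_compose2[OF Hc] continuous_intros) auto
  have "compact (frontier V \<times> {0..1::real})" using V(2) by (intro compact_Times compact_frontier_bounded) auto
  moreover have "continuous_on (frontier V \<times> {0..1}) (\<lambda>p. H p - \<alpha> (snd p))"
    by (intro continuous_intros continuous_on_subset[OF Hc] continuous_on_compose2[OF al]) (auto simp: frontier_def)
  moreover have "H p - \<alpha> (snd p) \<noteq> 0" if "p \<in> frontier V \<times> {0..1}" for p
    using that zero V(1,4) by (cases p) (auto simp: frontier_def interior_open)
  ultimately obtain m where m0: "0 < m" "\<And>p. p \<in> frontier V \<times> {0..1} \<Longrightarrow> m < norm (H p - \<alpha> (snd p))"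
    using compact_norm_lower_bound[of "frontier V \<times> {0..1}" "\<lambda>p. H p - \<alpha> (snd p)"] by blast
  then have m: "m < norm (H (x, t) - \<alpha> t)" if "x \<in> frontier V" "t \<in> {0..1}" for x t
    using that by (metis SigmaI snd_conv)
  have "compact (closure V \<times> {0..1::real})" using V(2) by (intro compact_Times) auto
  then have "uniformly_continuous_on (closure V \<times> {0..1}) H" using Hc by (intro compact_uniformly_continuous)
  from this[unfolded uniformly_continuous_on_def, rule_format, of "m / 8"]
  obtain d1 where d1: "0 < d1" "\<And>p q. p \<in> closure V \<times> {0..1} \<Longrightarrow> q \<in> closure V \<times> {0..1} \<Longrightarrow>
      dist q p < d1 \<Longrightarrow> dist (H q) (H p) < m / 8"
    using m0(1) by auto
  have "uniformly_continuous_on {0..1} \<alpha>" using al by (intro compact_uniformly_continuous) auto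
  from this[unfolded uniformly_continuous_on_def, rule_format, of "m / 8"]
  obtain d2 where d2: "0 < d2" "\<And>s t. s \<in> {0..1} \<Longrightarrow> t \<in> {0..1} \<Longrightarrow> dist t s < d2 \<Longrightarrow>
      dist (\<alpha> t) (\<alpha> s) < m / 8"
    using m0(1) by auto
  let ?D = "\<lambda>t. deg_admissible (\<lambda>x. H (x, t)) V (\<alpha> t)"
  \<comment> \<open>A pair \<open>(g, z)\<close> chosen at time \<open>t\<close> with errors
    \<open>m / 8\<close> is off by at most \<open>m / 4\<close> at a nearby time, since
    \<open>H\<close> and the path move by less than \<open>m / 8\<close>. As twice
    \<open>m / 4\<close> is below \<open>m\<close>, the same pair computes the degree at both
    times.\<close>
  have local: "?D t = ?D s" if t: "t \<in> {0..1}" and s: "s \<in> {0..1}" and st: "dist s t < min d1 d2" for s t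
  proof -
    have "compact (closure V)" using V(2) by simp
    then obtain g z where g: "polynomial_function g" "\<And>x. x \<in> closure V \<Longrightarrow> norm (g x - H (x, t)) \<le> m / 8"
      "norm (z - \<alpha> t) \<le> m / 8" "\<And>x. g x = z \<Longrightarrow> jacobian_det g x \<noteq> 0"
      using polynomial_approx_regular_value[OF _ Ht[OF t], of "m / 8" "\<alpha> t"] m0(1) by auto
    have "regular_approx (\<lambda>x. H (x, r)) V (\<alpha> r) g z" if r: "r \<in> {0..1}" "dist r t < min d1 d2" for r
    proof (rule regular_approxI[OF V(1,2) Ht[OF r(1)] g(1,4)])
      show "0 < m / 4" using m0(1) by simp
      show "norm (g x - H (x, r)) \<le> m / 4" if "x \<in> closure V" for x
      proof -
        have "dist (x, r) (x, t) = dist r t" by (simp add: dist_Pair_Pair)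
        then have "norm (H (x, r) - H (x, t)) < m / 8"
          using d1(2)[of "(x, t)" "(x, r)"] r t that by (simp add: dist_norm)
        then show ?thesis using g(2)[OF that] norm_triangle_ineq4[of "g x - H (x, t)" "H (x, r) - H (x, t)"]
          by simp
      qed
      have "norm (\<alpha> r - \<alpha> t) < m / 8" using d2(2)[OF t r(1)] r by (simp add: dist_norm)
      then show "norm (z - \<alpha> r) \<le> m / 4"
        using g(3) norm_triangle_ineq4[of "z - \<alpha> t" "\<alpha> r - \<alpha> t"] by simp
      show "2 * (m / 4) < norm (H (x, r) - \<alpha> r)" if "x \<in> frontier V" for x
        using m[OF that r(1)] m0(1) by simp
    qed
    from deg_admissible_eq[OF V(2) this[OF t]] deg_admissible_eq[OF V(2) this[OF s st]]
    show ?thesis using d1(1) d2(1) by simp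
  qed
  have "?D 0 = ?D 1"
  \<comment> \<open>The degree on \<open>V\<close> is locally constant in time, and the unit
    interval is connected.\<close>
  proof (rule connected_local_const[of "{0..1::real}"])
    show "\<forall>t\<in>{0..1}. \<forall>\<^sub>F s in at t within {0..1}. ?D t = ?D s"
      unfolding eventually_at using local d1(1) d2(1) by (metis min_less_iff_conj)
  qed auto
  moreover have "deg (\<lambda>x. H (x, t)) U (\<alpha> t) = ?D t" if "t \<in> {0..1}" for t
    by (rule deg_eq_deg_admissible[OF w[OF that] V(1,2) _ V(4)]) (use zero that in auto)
  ultimately show ?thesis by simp
qed

theorem theorem4p2:
  shows "deg (id :: real^'n \<Rightarrow> real^'n) UNIV 0 = 1 \<and>
    (\<forall>(f :: real^'n \<Rightarrow> real^'n) U y U1 U2.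
       weakly_admissible f U y \<and> open U1 \<and> open U2 \<and> U1 \<subseteq> U \<and> U2 \<subseteq> U \<and> U1 \<inter> U2 = {} \<and>
       {x \<in> U. f x = y} \<subseteq> U1 \<union> U2 \<longrightarrow>
       deg f U y = deg f U1 y + deg f U2 y) \<and>
    (\<forall>(H :: (real^'n) \<times> real \<Rightarrow> real^'n) U \<alpha>.
       weakly_admissible_homotopy H U \<alpha> \<longrightarrow>
       deg (\<lambda>x. H (x, 0)) U (\<alpha> 0) = deg (\<lambda>x. H (x, 1)) U (\<alpha> 1))"
  by (intro conjI allI impI deg_normalization deg_homotopy_invariance)
    (elim conjE, rule deg_additivity, assumption+)

end
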